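(* Let $\Sigma$ be a self-similar ruled surface in $\mathbb{R}^3$. Then $\Sigma$ is a cylinder over a self-similar planar curve.
   Context: $X$ denotes the position vector in Euclidean space $\mathbb{R}^3$, $N$ a local unit normal vector field of the surface, and $H$ the mean curvature, normalized by $2H=\frac{eG+gE-2fF}{EG-F^2}$, where for a local parametrization $X(s,t)$ one sets $E=|X_s|^2$, $F=\langle X_s,X_t\rangle$, $G=|X_t|^2$, $e=\langle X_{ss},N\rangle$, $f=\langle X_{st},N\rangle$, $g=\langle X_{tt},N\rangle$. A submanifold of Euclidean space is self-similar if there is a real constant $\lambda$ such that $\vec H+\lambda X^{\perp}=0$, where $\vec H$ is its mean curvature vector and $X^\perp$ is the projection of the position vector onto the normal space. For a surface in $\mathbb{R}^3$ this is the scalar equation $H+\lambda\langle X,N\rangle=0$; for a planar curve, $\vec H$ is the curvature vector of the curve. A surface is ruled if it is foliated by straight lines (the rulings); locally it is parametrized by an immersion $X:I\times\mathbb{R}\to\mathbb{R}^3$, $X(s,t)=\gamma(s)\,t+p(s)$, with $I$ an interval, $|\gamma(s)|=1$ and $\langle p(s),\gamma(s)\rangle=0$. A cylinder over a planar curve $c$ is a ruled surface with parallel rulings, i.e. of the form $\{c(s)+t v\}$, where $v$ is a fixed unit vector and $c$ is a curve contained in the plane through the origin orthogonal to $v$.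
   Formalization: The self-similarity constant λ is assumed nonzero (and the curve's constant is nonzero too): for λ = 0 the helicoid is a self-similar (minimal) ruled surface that is not a cylinder. Surfaces are taken to be connected. *)

theory Defs
  imports "HOL-Analysis.Analysis" "HOL-Library.Disjoint_Sets"
begin

text \<open>For an open set \<open>D\<close> in a Euclidean space, \<open>Ck_on k D f\<close> says that \<open>f\<close> is of class \<open>C\<^sup>k\<close>
  on \<open>D\<close>: the domain being finite-dimensional, it suffices that all directional derivatives
  of the derivative map are of class \<open>C\<^sup>k\<^sup>-\<^sup>1\<close>.\<close>

primrec Ck_on :: "nat \<Rightarrow> 'd::euclidean_space set \<Rightarrow> ('d \<Rightarrow> 'e::real_normed_vector) \<Rightarrow> bool" where
  "Ck_on 0 D f \<longleftrightarrow> continuous_on D f"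
| "Ck_on (Suc k) D f \<longleftrightarrow>
     (\<forall>x\<in>D. f differentiable (at x)) \<and> (\<forall>v. Ck_on k D (\<lambda>x. frechet_derivative f (at x) v))"

definition smooth_on :: "'d::euclidean_space set \<Rightarrow> ('d \<Rightarrow> 'e::real_normed_vector) \<Rightarrow> bool" where
  "smooth_on D f \<longleftrightarrow> (\<forall>k. Ck_on k D f)"

definition smooth_immersion_on ::
    "'d::euclidean_space set \<Rightarrow> ('d \<Rightarrow> 'e::real_normed_vector) \<Rightarrow> bool" where
  "smooth_immersion_on D f \<longleftrightarrow>
     open D \<and> smooth_on D f \<and> (\<forall>x\<in>D. inj (frechet_derivative f (at x)))"

text \<open>Surfaces and curves are connected and may have self-intersections (the self-similar planar
  curves include closed curves with crossings), so they are given as a topological manifold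
  \<open>S\<close> together with a map \<open>\<Phi>\<close> into space that is locally a smooth immersion. No separate smooth
  structure is recorded: since immersions are locally injective, the local parametrizations below
  have smooth transition maps, hence they form an atlas, the only one for which \<open>\<Phi>\<close> is an
  immersion.\<close>

definition local_parametrization ::
    "'a topology \<Rightarrow> ('a \<Rightarrow> 'e::real_normed_vector) \<Rightarrow> 'd::euclidean_space set \<Rightarrow> ('d \<Rightarrow> 'a) \<Rightarrow> bool"
where
  "local_parametrization S \<Phi> D h \<longleftrightarrow>
     openin S (h ` D) \<and> embedding_map (top_of_set D) S h \<and> smooth_immersion_on D (\<Phi> \<circ> h)"

definition immersed_surface :: "'a topology \<Rightarrow> ('a \<Rightarrow> real^3) \<Rightarrow> bool" where
  "immersed_surface S \<Phi> \<longleftrightarrow>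
     Hausdorff_space S \<and> second_countable S \<and> connected_space S \<and>
     (\<forall>x\<in>topspace S. \<exists>(D :: (real \<times> real) set) h. local_parametrization S \<Phi> D h \<and> x \<in> h ` D)"

definition immersed_curve :: "'a topology \<Rightarrow> ('a \<Rightarrow> real^3) \<Rightarrow> bool" where
  "immersed_curve C c \<longleftrightarrow>
     Hausdorff_space C \<and> second_countable C \<and> connected_space C \<and>
     (\<forall>x\<in>topspace C. \<exists>(D :: real set) h. local_parametrization C c D h \<and> x \<in> h ` D)"

definition deriv_s :: "(real \<times> real \<Rightarrow> real^3) \<Rightarrow> real \<times> real \<Rightarrow> real^3" where
  "deriv_s X q = frechet_derivative X (at q) (1, 0)"

definition deriv_t :: "(real \<times> real \<Rightarrow> real^3) \<Rightarrow> real \<times> real \<Rightarrow> real^3" where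
  "deriv_t X q = frechet_derivative X (at q) (0, 1)"

definition unit_normal_at :: "(real \<times> real \<Rightarrow> real^3) \<Rightarrow> real \<times> real \<Rightarrow> real^3 \<Rightarrow> bool" where
  "unit_normal_at X q N \<longleftrightarrow> norm N = 1 \<and> N \<bullet> deriv_s X q = 0 \<and> N \<bullet> deriv_t X q = 0"

definition mean_curvature :: "(real \<times> real \<Rightarrow> real^3) \<Rightarrow> real \<times> real \<Rightarrow> real^3 \<Rightarrow> real" where
  "mean_curvature X q N =
     (let E = deriv_s X q \<bullet> deriv_s X q;
          F = deriv_s X q \<bullet> deriv_t X q;
          G = deriv_t X q \<bullet> deriv_t X q;
          e = deriv_s (deriv_s X) q \<bullet> N;
          f = deriv_t (deriv_s X) q \<bullet> N;
          g = deriv_t (deriv_t X) q \<bullet> N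
      in (e * G + g * E - 2 * f * F) / (2 * (E * G - F\<^sup>2)))"

text \<open>The equation does not depend on the choice between the two unit normals, so it is required
  of both.\<close>

definition self_similar_surface :: "real \<Rightarrow> 'a topology \<Rightarrow> ('a \<Rightarrow> real^3) \<Rightarrow> bool" where
  "self_similar_surface lam S \<Phi> \<longleftrightarrow>
     immersed_surface S \<Phi> \<and>
     (\<forall>(D :: (real \<times> real) set) h. local_parametrization S \<Phi> D h \<longrightarrow>
        (\<forall>q\<in>D. \<forall>N. unit_normal_at (\<Phi> \<circ> h) q N \<longrightarrow>
           mean_curvature (\<Phi> \<circ> h) q N + lam * (\<Phi> (h q) \<bullet> N) = 0))"

definition velocity :: "(real \<Rightarrow> real^3) \<Rightarrow> real \<Rightarrow> real^3" where
  "velocity c s = vector_derivative c (at s)"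

definition unit_tangent :: "(real \<Rightarrow> real^3) \<Rightarrow> real \<Rightarrow> real^3" where
  "unit_tangent c s = velocity c s /\<^sub>R norm (velocity c s)"

definition curvature_vector :: "(real \<Rightarrow> real^3) \<Rightarrow> real \<Rightarrow> real^3" where
  "curvature_vector c s = velocity (unit_tangent c) s /\<^sub>R norm (velocity c s)"

definition normal_position :: "(real \<Rightarrow> real^3) \<Rightarrow> real \<Rightarrow> real^3" where
  "normal_position c s = c s - (c s \<bullet> unit_tangent c s) *\<^sub>R unit_tangent c s"

definition self_similar_curve :: "real \<Rightarrow> 'a topology \<Rightarrow> ('a \<Rightarrow> real^3) \<Rightarrow> bool" where
  "self_similar_curve \<mu> C c \<longleftrightarrow>
     immersed_curve C c \<and>
     (\<forall>(D :: real set) h. local_parametrization C c D h \<longrightarrow>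
        (\<forall>s\<in>D. curvature_vector (c \<circ> h) s + \<mu> *\<^sub>R normal_position (c \<circ> h) s = 0))"

text \<open>The leaves of the foliation are the members of \<open>L\<close>. Without the condition that the local
  rulings \<open>h ` ({s} \<times> UNIV)\<close> are leaves, the rulings of overlapping parametrizations need not
  agree; for instance a cross-shaped region in a plane, the union of two perpendicular strips,
  would then qualify.\<close>

definition ruled_surface :: "'a topology \<Rightarrow> ('a \<Rightarrow> real^3) \<Rightarrow> bool" where
  "ruled_surface S \<Phi> \<longleftrightarrow>
     immersed_surface S \<Phi> \<and>
     (\<exists>L. partition_on (topspace S) L \<and>
       (\<forall>x\<in>topspace S. \<exists>(I :: real set) h \<gamma> p.
          is_interval I \<and>
          local_parametrization S \<Phi> (I \<times> (UNIV :: real set)) h \<and>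
          x \<in> h ` (I \<times> UNIV) \<and>
          (\<forall>s\<in>I. norm (\<gamma> s) = 1 \<and> p s \<bullet> \<gamma> s = 0) \<and>
          (\<forall>s\<in>I. \<forall>t. \<Phi> (h (s, t)) = t *\<^sub>R \<gamma> s + p s) \<and>
          (\<forall>s\<in>I. h ` ({s} \<times> UNIV) \<in> L)))"

text \<open>The surface is the cylinder \<open>{c(x) + t v}\<close> as an immersed surface, that is up to a
  homeomorphism \<open>h\<close> of the parameter spaces. This \<open>h\<close> is automatically a diffeomorphism, as both
  sides are immersions.\<close>

definition cylinder_over ::
    "real^3 \<Rightarrow> 'b topology \<Rightarrow> ('b \<Rightarrow> real^3) \<Rightarrow> 'a topology \<Rightarrow> ('a \<Rightarrow> real^3) \<Rightarrow> bool" where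
  "cylinder_over v C c S \<Phi> \<longleftrightarrow>
     norm v = 1 \<and>
     immersed_curve C c \<and> (\<forall>x\<in>topspace C. c x \<bullet> v = 0) \<and>
     (\<exists>h. homeomorphic_map (prod_topology C euclideanreal) S h \<and>
          (\<forall>x\<in>topspace C. \<forall>t. \<Phi> (h (x, t)) = c x + t *\<^sub>R v))"

end

theory Submission
  imports Defs
begin

text \<open>Along a ruling, the self-similarity equation of \<open>X(s,t) = t \<gamma>(s) + p(s)\<close> is a cubic polynomial in
  \<open>t\<close>. Suppose \<open>\<gamma>' \<noteq> 0\<close>. The cubic coefficient gives \<open>\<langle>p, \<gamma>' \<times> \<gamma>\<rangle> = 0\<close>, hence \<open>p = a \<gamma>'\<close>. As \<open>X\<close> is an
  immersion even where \<open>t \<gamma>' + p'\<close> has no \<open>\<gamma>'\<close> component, \<open>\<langle>p', \<gamma>' \<times> \<gamma>\<rangle> \<noteq> 0\<close>, and the quadratic coefficient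
  then forces \<open>2 \<lambda> |p|\<^sup>2 = 1\<close>. Differentiating this twice and inserting it into the constant
  coefficient gives a contradiction. So \<open>\<gamma>\<close> is constant on every chart and, \<open>S\<close> being connected, all
  rulings are parallel to one vector \<open>v\<close>. Every leaf meets \<open>C = {x. \<langle>\<Phi> x, v\<rangle> = 0}\<close> exactly once, and
  sliding along the leaves is a homeomorphism \<open>C \<times> \<real> \<rightarrow> S\<close>. It turns each local parametrization of
  \<open>C\<close> into one of \<open>S\<close>, where the surface equation becomes the curve equation with constant \<open>2 \<lambda>\<close>;
  the factor comes from \<open>H\<close> being half the curvature.\<close>

subsection \<open>Maps of class \<open>C\<^sup>k\<close>\<close>

lemma Ck_on_cong:
  assumes "open D" "Ck_on k D f" "\<And>x. x \<in> D \<Longrightarrow> f x = g x"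
  shows "Ck_on k D g"
  using assms(2,3)
proof (induction k arbitrary: f g)
  case 0
  then show ?case by (simp cong: continuous_on_cong)
next
  case (Suc k)
  have g: "(g has_derivative frechet_derivative f (at x)) (at x)" if "x \<in> D" for x
    using has_derivative_transform_within_open[OF _ \<open>open D\<close> that, of f _ UNIV g] Suc.prems that
    by (simp add: frechet_derivative_works)
  have "frechet_derivative f (at x) = frechet_derivative g (at x)" if "x \<in> D" for x
    using frechet_derivative_at[OF g[OF that]] .
  then have "Ck_on k D (\<lambda>x. frechet_derivative g (at x) v)" for v
    using Suc.IH[of "\<lambda>x. frechet_derivative f (at x) v" "\<lambda>x. frechet_derivative g (at x) v"] Suc.prems(1)
    by simp
  moreover have "g differentiable (at x)" if "x \<in> D" for x
    using g[OF that] differentiable_def by blast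
  ultimately show ?case by simp
qed

text \<open>\<open>Ck_on\<close> is phrased through \<open>frechet_derivative\<close>. As
  derivatives at a point are unique, an explicit derivative \<open>f'\<close> may take its
  place.\<close>

lemma Ck_on_SucI:
  assumes "open D" "\<And>x. x \<in> D \<Longrightarrow> (f has_derivative f' x) (at x)" "\<And>v. Ck_on k D (\<lambda>x. f' x v)"
  shows "Ck_on (Suc k) D f"
proof -
  have "f' x = frechet_derivative f (at x)" if "x \<in> D" for x
    using frechet_derivative_at[OF assms(2)[OF that]] .
  then have "Ck_on k D (\<lambda>x. frechet_derivative f (at x) v)" for v
    using Ck_on_cong[OF assms(1) assms(3)] by simp
  then show ?thesis
    using assms(2) by (auto simp: differentiable_def)
qed

lemma Ck_on_Suc_has_derivative:
  assumes "Ck_on (Suc k) D f" "x \<in> D"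
  shows "(f has_derivative frechet_derivative f (at x)) (at x)"
  using assms by (simp add: frechet_derivative_works)

lemma Ck_on_const: "open D \<Longrightarrow> Ck_on k D (\<lambda>x. c)"
proof (induction k arbitrary: c)
  case (Suc k)
  then show ?case by (intro Ck_on_SucI[where f' = "\<lambda>_ _. 0"]) auto
qed simp

lemma Ck_on_bounded_linear:
  assumes "open D" "bounded_linear L"
  shows "Ck_on k D L"
proof (cases k)
  case 0
  then show ?thesis using assms(2) by (simp add: linear_continuous_on)
next
  case (Suc m)
  have "Ck_on (Suc m) D L"
    by (rule Ck_on_SucI[OF assms(1) bounded_linear_imp_has_derivative[OF assms(2)] Ck_on_const[OF assms(1)]])
  then show ?thesis using Suc by simp
qed

lemma Ck_on_linear_combination:
  assumes "open D" "Ck_on k D f" "Ck_on k D g"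
  shows "Ck_on k D (\<lambda>x. a *\<^sub>R f x + b *\<^sub>R g x)"
  using assms(2,3)
proof (induction k arbitrary: f g)
  case 0
  then show ?case by (auto intro!: continuous_intros)
next
  case (Suc k)
  show ?case
  proof (rule Ck_on_SucI[OF assms(1)])
    show "((\<lambda>x. a *\<^sub>R f x + b *\<^sub>R g x) has_derivative
        (\<lambda>v. a *\<^sub>R frechet_derivative f (at x) v + b *\<^sub>R frechet_derivative g (at x) v)) (at x)" if "x \<in> D" for x
      using Ck_on_Suc_has_derivative[OF Suc.prems(1) that] Ck_on_Suc_has_derivative[OF Suc.prems(2) that]
      by (intro derivative_intros)
    show "Ck_on k D (\<lambda>x. a *\<^sub>R frechet_derivative f (at x) v + b *\<^sub>R frechet_derivative g (at x) v)" for v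
      using Suc by simp
  qed
qed

text \<open>The inner map has a constant derivative, so each directional derivative of the composite
  is a directional derivative of \<open>f\<close> composed with the same affine map. This closes the
  induction.\<close>

lemma Ck_on_compose_affine:
  assumes "open D" "open D'" "bounded_linear L" "\<And>x. x \<in> D' \<Longrightarrow> L x + b \<in> D" "Ck_on k D f"
  shows "Ck_on k D' (\<lambda>x. f (L x + b))"
  using assms(5)
proof (induction k arbitrary: f)
  case 0
  then show ?case
    using assms(4) linear_continuous_on[OF assms(3)]
    by (auto intro!: continuous_on_compose2[of D f] continuous_intros)
next
  case (Suc k)
  show ?case
  proof (rule Ck_on_SucI[OF assms(2)])
    show "((\<lambda>x. f (L x + b)) has_derivative (\<lambda>v. frechet_derivative f (at (L x + b)) (L v))) (at x)"
      if "x \<in> D'" for x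
    proof -
      have "((\<lambda>x. L x + b) has_derivative L) (at x)"
        using has_derivative_add[OF bounded_linear_imp_has_derivative[OF assms(3)] has_derivative_const] by fastforce
      from has_derivative_compose[OF this Ck_on_Suc_has_derivative[OF Suc.prems assms(4)[OF that]]]
      show ?thesis .
    qed
    show "Ck_on k D' (\<lambda>x. frechet_derivative f (at (L x + b)) (L v))" for v
      using Suc.IH[of "\<lambda>x. frechet_derivative f (at x) (L v)"] Suc.prems by simp
  qed
qed

lemma Ck_on_real_vector_derivatives:
  fixes f :: "real \<Rightarrow> 'e::real_normed_vector"
  assumes "Ck_on 2 I f"
  obtains f1 f2 where
    "\<And>s. s \<in> I \<Longrightarrow> (f has_vector_derivative f1 s) (at s)"
    "\<And>s. s \<in> I \<Longrightarrow> (f1 has_vector_derivative f2 s) (at s)"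
proof -
  have *: "(g has_vector_derivative frechet_derivative g (at s) 1) (at s)"
    if "g differentiable (at s)" for g :: "real \<Rightarrow> 'e" and s
  proof -
    let ?F = "frechet_derivative g (at s)"
    have F: "(g has_derivative ?F) (at s)" using that by (simp add: frechet_derivative_works)
    have "?F h = h *\<^sub>R ?F 1" for h
      using linear_cmul[OF has_derivative_linear[OF F], of h 1] by simp
    then show ?thesis unfolding has_vector_derivative_def using F by (metis (no_types, lifting) ext)
  qed
  show ?thesis
  proof (rule that)
    show "(f has_vector_derivative frechet_derivative f (at s) 1) (at s)" if "s \<in> I" for s
      using assms that by (intro *) (simp add: numeral_2_eq_2)
    show "((\<lambda>s. frechet_derivative f (at s) 1) has_vector_derivative
       frechet_derivative (\<lambda>s. frechet_derivative f (at s) 1) (at s) 1) (at s)" if "s \<in> I" for s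
      using assms that by (intro *) (simp add: numeral_2_eq_2)
  qed
qed

text \<open>\<open>ruled_surface\<close> asks for no regularity of \<gamma> and p. It is inherited
  from the chart: p is its restriction to t = 0, and \<gamma> is the difference of its restrictions
  to t = 1 and t = 0.\<close>

lemma smooth_on_lines:
  fixes X :: "real \<times> real \<Rightarrow> real^3"
  assumes "open I" "smooth_on (I \<times> UNIV) X" "\<And>s t. s \<in> I \<Longrightarrow> X (s, t) = t *\<^sub>R \<gamma> s + p s"
  shows "smooth_on I \<gamma>" "smooth_on I p"
proof -
  have X: "Ck_on k I (\<lambda>s. X (s, t))" for k t
    using Ck_on_compose_affine[of "I \<times> UNIV" I "\<lambda>s. (s, 0)" "(0, t)" k X] assms(1,2)
    by (simp add: open_Times smooth_on_def bounded_linear_Pair bounded_linear_ident bounded_linear_zero)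
  show "smooth_on I p"
    unfolding smooth_on_def using Ck_on_cong[OF assms(1) X[of _ 0]] assms(3) by simp
  have "Ck_on k I (\<lambda>s. 1 *\<^sub>R X (s, 1) + (-1) *\<^sub>R X (s, 0))" for k
    by (intro Ck_on_linear_combination X assms)
  then show "smooth_on I \<gamma>"
    unfolding smooth_on_def using Ck_on_cong[OF assms(1)] assms(3) by fastforce
qed

lemma smooth_on_cylinder:
  fixes c :: "real \<Rightarrow> 'e::euclidean_space"
  assumes "open D" "smooth_on D c"
  shows "smooth_on (D \<times> (UNIV :: real set)) (\<lambda>(s, t). t *\<^sub>R v + c s)"
proof -
  have D: "open (D \<times> (UNIV :: real set))" using assms by (simp add: open_Times)
  have "Ck_on k (D \<times> (UNIV :: real set)) (\<lambda>q. c (fst q + 0))" for k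
    by (rule Ck_on_compose_affine[of D])
      (use assms D in \<open>auto simp: bounded_linear_fst smooth_on_def\<close>)
  moreover have "Ck_on k (D \<times> (UNIV :: real set)) (\<lambda>q. snd q *\<^sub>R v)" for k
    using D bounded_linear_snd by (intro Ck_on_bounded_linear) (auto intro: bounded_linear_scaleR_const)
  ultimately have "Ck_on k (D \<times> UNIV) (\<lambda>q. 1 *\<^sub>R (snd q *\<^sub>R v) + 1 *\<^sub>R c (fst q + 0))" for k
    using D by (intro Ck_on_linear_combination)
  then show ?thesis by (simp add: smooth_on_def case_prod_unfold)
qed

lemma lines_has_derivative:
  fixes X :: "real \<times> real \<Rightarrow> real^3"
  assumes "open I" "s \<in> I" "\<And>s t. s \<in> I \<Longrightarrow> X (s, t) = t *\<^sub>R \<gamma> s + p s"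
    and "(\<gamma> has_vector_derivative \<gamma>') (at s)" "(p has_vector_derivative p') (at s)"
  shows "(X has_derivative (\<lambda>q. fst q *\<^sub>R (t *\<^sub>R \<gamma>' + p') + snd q *\<^sub>R \<gamma> s)) (at (s, t))"
proof -
  have f: "(fst has_derivative fst) (at (s, t))"  by (simp add: bounded_linear_imp_has_derivative bounded_linear_fst)
  have "((\<lambda>q. f (fst q)) has_derivative (\<lambda>q. fst q *\<^sub>R f')) (at (s, t))"
    if "(f has_vector_derivative f') (at s)" for f :: "real \<Rightarrow> real^3" and f'
    using has_derivative_compose[OF f, of f "\<lambda>h. h *\<^sub>R f'"] that unfolding has_vector_derivative_def by simp
  note * = this[OF assms(4)] this[OF assms(5)]
  have "((\<lambda>q. snd q *\<^sub>R \<gamma> (fst q) + p (fst q)) has_derivative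
     (\<lambda>q. fst q *\<^sub>R (t *\<^sub>R \<gamma>' + p') + snd q *\<^sub>R \<gamma> s)) (at (s, t))"
    by (rule derivative_eq_intros * refl)+ (simp add: algebra_simps fun_eq_iff)
  then show ?thesis
    by (rule has_derivative_transform_within_open[where s = "I \<times> UNIV"])
      (use assms in \<open>auto simp: open_Times\<close>)
qed

text \<open>Both partial derivatives are again families of lines, so a second application yields the
  second derivatives.\<close>

lemma lines_deriv:
  fixes X :: "real \<times> real \<Rightarrow> real^3"
  assumes "open I" "s \<in> I" "\<And>s t. s \<in> I \<Longrightarrow> X (s, t) = t *\<^sub>R \<gamma> s + p s"
    and "(\<gamma> has_vector_derivative \<gamma>') (at s)" "(p has_vector_derivative p') (at s)"
  shows "deriv_s X (s, t) = t *\<^sub>R \<gamma>' + p'" "deriv_t X (s, t) = \<gamma> s"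
  unfolding deriv_s_def deriv_t_def using frechet_derivative_at[OF lines_has_derivative[OF assms], of t]
  by (metis (no_types, lifting) add.right_neutral add.left_neutral fst_conv snd_conv scaleR_one scaleR_zero_left)+

subsection \<open>The self-similarity equation along a ruling\<close>

unbundle cross3_syntax

text \<open>The expansion of x in the frame g, h, h \<times> g, multiplied by the Gram determinant
  of g and h to avoid division. In coordinates it is a polynomial identity.\<close>

lemma cross3_frame_expansion:
  fixes g h x :: "real^3"
  shows "((h \<times> g) \<bullet> (h \<times> g)) *\<^sub>R x =
    ((x \<bullet> g) * (h \<bullet> h) - (x \<bullet> h) * (g \<bullet> h)) *\<^sub>R g + ((x \<bullet> h) * (g \<bullet> g) - (x \<bullet> g) * (g \<bullet> h)) *\<^sub>R h
    + (x \<bullet> (h \<times> g)) *\<^sub>R (h \<times> g)"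
  by (simp add: vec_eq_iff forall_3 cross3_def inner_vec_def sum_3 vector_3 algebra_simps)

lemma cross3_frame_expansion_orthonormal:
  fixes g h x :: "real^3"
  assumes "g \<bullet> g = 1" "g \<bullet> h = 0"
  shows "(h \<bullet> h) *\<^sub>R x = ((h \<bullet> h) * (x \<bullet> g)) *\<^sub>R g + (x \<bullet> h) *\<^sub>R h + (x \<bullet> (h \<times> g)) *\<^sub>R (h \<times> g)"
  using cross3_frame_expansion[where x = x and g=g and h=h] assms
   by (simp add: dot_cross inner_commute mult.commute)

text \<open>A cubic is determined by its values at the four points 0, 1, -1 and 2.\<close>

lemma cubic_coeffs_zero:
  fixes a b c d :: real
  assumes "\<And>t. a * t^3 + b * t\<^sup>2 + c * t + d = 0"
  shows "a = 0" "b = 0" "c = 0" "d = 0"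
  using assms[of 0] assms[of 1] assms[of "-1"] assms[of 2] by simp_all

text \<open>Here \<open>g1\<close>, \<open>g2\<close>, \<open>p1\<close>, \<open>p2\<close> stand for the values of \<open>\<gamma>'\<close>, \<open>\<gamma>''\<close>, \<open>p'\<close>, \<open>p''\<close> at one
  parameter.\<close>

lemma ruled_coeffs:
  fixes g g1 g2 p p1 p2 :: "real^3" and lam :: real
  assumes "g1 \<bullet> g = 0"
    and eq: "\<And>t. (t *\<^sub>R g2 + p2) \<bullet> ((t *\<^sub>R g1 + p1) \<times> g)
         - 2 * (g1 \<bullet> ((t *\<^sub>R g1 + p1) \<times> g)) * ((t *\<^sub>R g1 + p1) \<bullet> g)
         + 2 * lam * (((t *\<^sub>R g1 + p1) \<times> g) \<bullet> ((t *\<^sub>R g1 + p1) \<times> g)) * (p \<bullet> ((t *\<^sub>R g1 + p1) \<times> g)) = 0"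
  defines "A \<equiv> g1 \<times> g" and "B \<equiv> p1 \<times> g"
  shows "lam * (A \<bullet> A) * (p \<bullet> A) = 0"
    and "g2 \<bullet> A + 2 * lam * ((A \<bullet> A) * (p \<bullet> B) + 2 * (A \<bullet> B) * (p \<bullet> A)) = 0"
    and "p2 \<bullet> B - 2 * (g1 \<bullet> B) * (p1 \<bullet> g) + 2 * lam * (B \<bullet> B) * (p \<bullet> B) = 0"
proof -
  have n: "(t *\<^sub>R g1 + p1) \<times> g = t *\<^sub>R A + B" for t
    unfolding A_def B_def by (simp add: cross_add_left cross_mult_left)
  have [simp]: "A \<bullet> g1 = 0" unfolding A_def by (simp add: dot_cross_self)
  note * = eq[unfolded n]
  \<comment> \<open>As \<open>g1\<close> is orthogonal to both \<open>g\<close> and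
    \<open>A\<close>, the second term of \<open>eq\<close> is free of \<open>t\<close> and enters
    only the constant coefficient. Degree three arises only from the term with
    \<open>lam\<close>.\<close>
  have "(2 * lam * (A \<bullet> A) * (p \<bullet> A)) * t^3
      + (g2 \<bullet> A + 2 * lam * ((A \<bullet> A) * (p \<bullet> B) + 2 * (A \<bullet> B) * (p \<bullet> A))) * t\<^sup>2
      + (g2 \<bullet> B + p2 \<bullet> A + 2 * lam * (2 * (A \<bullet> B) * (p \<bullet> B) + (B \<bullet> B) * (p \<bullet> A))) * t
      + (p2 \<bullet> B - 2 * (g1 \<bullet> B) * (p1 \<bullet> g) + 2 * lam * (B \<bullet> B) * (p \<bullet> B)) = 0" for t
    using *[of t] assms(1)
    by (simp add: inner_simps inner_commute algebra_simps power2_eq_square power3_eq_cube)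
  from cubic_coeffs_zero[OF this]
  show "lam * (A \<bullet> A) * (p \<bullet> A) = 0"
    and "g2 \<bullet> A + 2 * lam * ((A \<bullet> A) * (p \<bullet> B) + 2 * (A \<bullet> B) * (p \<bullet> A)) = 0"
    and "p2 \<bullet> B - 2 * (g1 \<bullet> B) * (p1 \<bullet> g) + 2 * lam * (B \<bullet> B) * (p \<bullet> B) = 0"
    by simp_all
qed

section \<open>Stationarity of the ruling direction\<close>

lemma has_derivative_const_on_open:
  fixes f :: "real \<Rightarrow> real"
  assumes "open J" "s \<in> J" "\<And>x. x \<in> J \<Longrightarrow> f x = k" "(f has_real_derivative d) (at s)"
  shows "d = 0"
proof -
  have "(f has_real_derivative 0) (at s)"
    by (rule has_field_derivative_transform_within_open[where f="\<lambda>_. k" and S = J]) (use assms in auto)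
  then show ?thesis using assms(4) DERIV_unique by blast
qed

lemma has_real_derivative_inner:
  fixes f g :: "real \<Rightarrow> 'a::real_inner"
  assumes "(f has_vector_derivative f') (at s)" "(g has_vector_derivative g') (at s)"
  shows "((\<lambda>s. f s \<bullet> g s) has_real_derivative f' \<bullet> g s + f s \<bullet> g') (at s)"
  using bounded_bilinear.has_vector_derivative[OF bounded_bilinear_inner assms]
  by (simp add: has_real_derivative_iff_has_vector_derivative add.commute)

lemma ruling_direction_stationary:
  fixes g g1 g2 p p1 p2 :: "real \<Rightarrow> real^3" and lam :: real
  assumes J: "open J"
    and dg: "\<And>s. s \<in> J \<Longrightarrow> (g has_vector_derivative g1 s) (at s)"
    and dg1: "\<And>s. s \<in> J \<Longrightarrow> (g1 has_vector_derivative g2 s) (at s)"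
    and dp: "\<And>s. s \<in> J \<Longrightarrow> (p has_vector_derivative p1 s) (at s)"
    and dp1: "\<And>s. s \<in> J \<Longrightarrow> (p1 has_vector_derivative p2 s) (at s)"
    and unit: "\<And>s. s \<in> J \<Longrightarrow> g s \<bullet> g s = 1"
    and orth: "\<And>s. s \<in> J \<Longrightarrow> p s \<bullet> g s = 0"
    and lam: "lam \<noteq> 0"
    and immersion: "\<And>s t. s \<in> J \<Longrightarrow> (t *\<^sub>R g1 s + p1 s) \<times> g s \<noteq> 0"
    and eq: "\<And>s t. s \<in> J \<Longrightarrow> (t *\<^sub>R g2 s + p2 s) \<bullet> ((t *\<^sub>R g1 s + p1 s) \<times> g s)
         - 2 * (g1 s \<bullet> ((t *\<^sub>R g1 s + p1 s) \<times> g s)) * ((t *\<^sub>R g1 s + p1 s) \<bullet> g s)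
         + 2 * lam * (((t *\<^sub>R g1 s + p1 s) \<times> g s) \<bullet> ((t *\<^sub>R g1 s + p1 s) \<times> g s))
           * (p s \<bullet> ((t *\<^sub>R g1 s + p1 s) \<times> g s)) = 0"
    and s: "s \<in> J"
  shows "g1 s = 0"
proof (rule ccontr)
  assume nz: "g1 s \<noteq> 0"
  \<comment> \<open>The identities \<open>pA\<close>, \<open>pp\<close> and \<open>p_p1\<close> rely
    on \<open>g1\<close> being nonzero. They are established on the whole open set \<open>K\<close>
    so that they can be differentiated at a point.\<close>
  define K where "K = {s \<in> J. g1 s \<noteq> 0}"
  have "continuous_on J g1"
    using dg1 J by (meson continuous_at_imp_continuous_on has_vector_derivative_continuous)
  then have K: "open K"
    unfolding K_def using continuous_open_preimage[OF _ J, of g1 "-{0}"]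
    by (simp add: vimage_def Int_def open_delete Compl_eq_Diff_UNIV)
  have sK: "s \<in> K" using nz s by (simp add: K_def)
  have KJ: "x \<in> J" if "x \<in> K" for x using that by (simp add: K_def)
  have g1g: "g1 x \<bullet> g x = 0" if "x \<in> J" for x
    using has_derivative_const_on_open[OF J that unit has_real_derivative_inner[OF dg[OF that] dg[OF that]]]
    by (simp add: inner_commute)
  have AA: "(g1 x \<times> g x) \<bullet> (g1 x \<times> g x) = g1 x \<bullet> g1 x" if "x \<in> J" for x
    using that g1g[OF that] unit[OF that] by (simp add: dot_cross inner_commute)
  have q: "g1 x \<bullet> g1 x \<noteq> 0" if "x \<in> K" for x using that by (simp add: K_def)
  note coeffs = ruled_coeffs[OF g1g eq]
  have pA: "p x \<bullet> (g1 x \<times> g x) = 0" if "x \<in> K" for x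
    using coeffs(1)[OF KJ[OF that] KJ[OF that]] AA[OF KJ[OF that]] q[OF that] lam by simp
  define a where "a x = (p x \<bullet> g1 x) / (g1 x \<bullet> g1 x)" for x
  \<comment> \<open>By \<open>orth\<close> and \<open>pA\<close>, only the component along
    \<open>g1 x\<close> survives in the frame \<open>g x\<close>, \<open>g1 x\<close>,
    \<open>g1 x \<times> g x\<close>.\<close>
  have pa: "p x = a x *\<^sub>R g1 x" if "x \<in> K" for x
  proof -
    have "(g1 x \<bullet> g1 x) *\<^sub>R p x = (p x \<bullet> g1 x) *\<^sub>R g1 x"
      using cross3_frame_expansion_orthonormal[where x = "p x" and g = "g x" and h = "g1 x"]
        unit[OF KJ[OF that]] g1g[OF KJ[OF that]] orth[OF KJ[OF that]] pA[OF that]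
      by (simp add: inner_commute)
    then show ?thesis using q[OF that] unfolding a_def
      by (metis divide_inverse_commute eq_vector_fraction_iff scaleR_scaleR divide_inverse)
  qed
  \<comment> \<open>This is the derivative of \<open>pA\<close>. In the derivative of the cross
    product only \<open>g2 x \<times> g x\<close> is left, and the triple product with
    \<open>p x\<close>, a multiple of \<open>g1 x\<close>, changes sign when \<open>g1 x\<close> and
    \<open>g2 x\<close> are swapped.\<close>
  have p1A: "p1 x \<bullet> (g1 x \<times> g x) = a x * (g2 x \<bullet> (g1 x \<times> g x))" if "x \<in> K" for x
  proof -
    note x = KJ[OF that]
    have "((\<lambda>s. g1 s \<times> g s) has_vector_derivative (g1 x \<times> g1 x + g2 x \<times> g x)) (at x)"
      using bounded_bilinear.has_vector_derivative[OF bilinear_conv_bounded_bilinear[THEN iffD1, OF bilinear_cross] dg1[OF x] dg[OF x]] by simp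
    from has_derivative_const_on_open[OF K that pA has_real_derivative_inner[OF dp[OF x] this]]
    have "p1 x \<bullet> (g1 x \<times> g x) + p x \<bullet> (g2 x \<times> g x) = 0"
      by simp
    moreover have "p x \<bullet> (g2 x \<times> g x) = - a x * (g2 x \<bullet> (g1 x \<times> g x))"
      unfolding pa[OF that] by (simp add: cross3_simps)
    ultimately show ?thesis by simp
  qed
  \<comment> \<open>Otherwise p' lies in the span of \<gamma> and \<gamma>', and the parameter t =
    -\<langle>p', \<gamma>'\<rangle> / |\<gamma>'|^2 makes t \<gamma>' + p' a multiple of \<gamma>,
    against \<open>immersion\<close>.\<close>
  have p1A_nz: "p1 x \<bullet> (g1 x \<times> g x) \<noteq> 0" if "x \<in> K" for x
  proof
    assume "p1 x \<bullet> (g1 x \<times> g x) = 0"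
    define q where "q = g1 x \<bullet> g1 x"
    have "q *\<^sub>R p1 x = (q * (p1 x \<bullet> g x)) *\<^sub>R g x + (p1 x \<bullet> g1 x) *\<^sub>R g1 x"
      using cross3_frame_expansion_orthonormal[where x = "p1 x" and g = "g x" and h = "g1 x"]
        unit[OF KJ[OF that]] g1g[OF KJ[OF that]] \<open>p1 x \<bullet> _ = 0\<close>
      by (simp add: inner_commute q_def)
    then have "q *\<^sub>R ((-(p1 x \<bullet> g1 x) / q) *\<^sub>R g1 x + p1 x) = (q * (p1 x \<bullet> g x)) *\<^sub>R g x"
      using q[OF that] by (simp add: q_def[symmetric] scaleR_diff_right)
    then have "(q *\<^sub>R ((-(p1 x \<bullet> g1 x) / q) *\<^sub>R g1 x + p1 x)) \<times> g x = 0"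
      by (simp only: cross_mult_left) simp
    then have "((-(p1 x \<bullet> g1 x) / q) *\<^sub>R g1 x + p1 x) \<times> g x = 0"
      using q[OF that] unfolding cross_mult_left by (simp add: q_def[symmetric])
    with immersion[OF KJ[OF that]] show False by blast
  qed
  have pB: "p x \<bullet> (p1 x \<times> g x) = - a x * (p1 x \<bullet> (g1 x \<times> g x))" if "x \<in> K" for x
    unfolding pa[OF that] by (simp add: cross3_simps)
  \<comment> \<open>After substitution the quadratic coefficient is \<open>d\<close> times 1 - 2
    \<lambda> |p|^2. Here \<open>d\<close> is nonzero because \<open>a x * d\<close> is the nonzero
    number in \<open>p1A_nz\<close>.\<close>
  have pp: "p x \<bullet> p x = 1 / (2 * lam)" if "x \<in> K" for x
  proof -
    define d where "d = g2 x \<bullet> (g1 x \<times> g x)"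
    have "d \<noteq> 0" using p1A_nz[OF that] p1A[OF that] by (simp add: d_def)
    have "p x \<bullet> p x = (g1 x \<bullet> g1 x) * (a x)\<^sup>2"
      unfolding pa[OF that] by (simp add: power2_eq_square)
    moreover have "d + 2 * lam * ((g1 x \<bullet> g1 x) * (- a x * (a x * d))) = 0"
      using coeffs(2)[OF KJ[OF that] KJ[OF that]]
      unfolding AA[OF KJ[OF that]] pB[OF that] pA[OF that] p1A[OF that] d_def by simp
    then have "2 * lam * ((g1 x \<bullet> g1 x) * (a x)\<^sup>2) = 1"
      using \<open>d \<noteq> 0\<close> by (simp add: power2_eq_square)
    ultimately show ?thesis using lam by (simp add: field_simps)
  qed
  have p_p1: "p x \<bullet> p1 x = 0" if "x \<in> K" for x
    using has_derivative_const_on_open[OF K that pp has_real_derivative_inner[OF dp dp]] KJ[OF that]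
    by (simp add: inner_commute)
  note sJ = KJ[OF sK]
  have p_p2: "p1 s \<bullet> p1 s + p s \<bullet> p2 s = 0"
    using has_derivative_const_on_open[OF K sK p_p1 has_real_derivative_inner[OF dp dp1]] sJ by simp
  \<comment> \<open>Coordinates at \<open>s\<close>: \<open>Q\<close> is |\<gamma>'|^2 and
    \<open>w\<close> the coefficient of p' along \<gamma>' \<times> \<gamma>. By
    \<open>p_p1\<close>, p' has no component along \<gamma>'; its component along \<gamma> is
    \<open>F\<close>, from differentiating \<open>orth\<close>.\<close>
  define Q where "Q = g1 s \<bullet> g1 s"
  define w where "w = (p1 s \<bullet> (g1 s \<times> g s)) / Q"
  have Q: "Q \<noteq> 0" using q[OF sK] by (simp add: Q_def)
  have w: "w \<noteq> 0" using Q p1A_nz[OF sK] by (simp add: w_def)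
  have a: "a s \<noteq> 0" using pp[OF sK] lam pa[OF sK] by auto
  have 1: "2 * lam * (Q * (a s)\<^sup>2) = 1"
    using pp[OF sK] lam unfolding pa[OF sK] by (simp add: Q_def power2_eq_square field_simps)
  have F: "p1 s \<bullet> g s = - a s * Q"
    using has_derivative_const_on_open[OF J sJ orth has_real_derivative_inner[OF dp[OF sJ] dg[OF sJ]]]
    unfolding pa[OF sK] by (simp add: Q_def)
  have "Q *\<^sub>R p1 s = (Q * (p1 s \<bullet> g s)) *\<^sub>R g s + (p1 s \<bullet> (g1 s \<times> g s)) *\<^sub>R (g1 s \<times> g s)"
    using cross3_frame_expansion_orthonormal[where x = "p1 s" and g = "g s" and h = "g1 s"]
        unit[OF sJ] g1g[OF sJ] p_p1[OF sK] a unfolding pa[OF sK] by (simp add: inner_commute Q_def)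
  also have "\<dots> = Q *\<^sub>R ((- a s * Q) *\<^sub>R g s + w *\<^sub>R (g1 s \<times> g s))"
    using Q by (simp add: F w_def scaleR_diff_right)
  finally have p1: "p1 s = (- a s * Q) *\<^sub>R g s + w *\<^sub>R (g1 s \<times> g s)"
    using Q by (metis scaleR_cancel_left)
  have "(g1 s \<times> g s) \<times> g s = - g1 s"
    using Lagrange[of "g s" "g1 s" "g s"] unit[OF sJ] g1g[OF sJ]
    by (metis cross_skew inner_commute minus_equation_iff scaleR_one scaleR_zero_left diff_zero)
  then have B: "p1 s \<times> g s = - w *\<^sub>R g1 s"
    by (subst p1) (simp only: cross_add_left cross_mult_left, simp)
  have "p1 s \<bullet> p1 s = (a s * Q)\<^sup>2 + w\<^sup>2 * Q"
    using unit[OF sJ] AA[OF sJ]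
    by (subst p1, subst p1) (simp add: inner_simps dot_cross_self power2_eq_square Q_def inner_commute)
  then have p2: "p2 s \<bullet> g1 s = - ((a s * Q)\<^sup>2 + w\<^sup>2 * Q) / a s"
    using p_p2 a unfolding pa[OF sK] by (simp add: field_simps inner_commute)
  have "- w * (- ((a s * Q)\<^sup>2 + w\<^sup>2 * Q) / a s) - 2 * (- w * Q) * (- a s * Q) + 2 * lam * (w\<^sup>2 * Q) * (- w * a s * Q) = 0"
    using coeffs(3)[OF sJ sJ]
    unfolding B F by (simp add: pa[OF sK] p2 Q_def[symmetric] power2_eq_square mult.assoc)
  \<comment> \<open>The constant coefficient, multiplied by \<open>a s\<close>. Replacing the
    bracket with \<open>lam\<close> by 1 cancels the two terms w^3 Q, and -w (a Q)^2 is left, a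
    product of nonzero factors.\<close>
  then have "w * ((a s * Q)\<^sup>2 + w\<^sup>2 * Q) - 2 * w * Q\<^sup>2 * (a s)\<^sup>2 - (2 * lam * (Q * (a s)\<^sup>2)) * w^3 * Q = 0"
    using a by (simp add: field_simps power2_eq_square power3_eq_cube)
  then have "w * (a s * Q)\<^sup>2 = 0"
    unfolding 1 by (simp add: algebra_simps power2_eq_square power3_eq_cube)
  then show False using w a Q by simp
qed

text \<open>With normal direction n = X_s \<times> X_t one has EG - F^2 = |n|^2, while G = 1 and
  X_tt = 0 reduce the numerator of 2H to e - 2fF. Since \<gamma> is orthogonal to n, only p
  contributes to \<langle>X, n\<rangle>. Multiplying by 2 |n|^3 removes the denominators, and the
  equation becomes polynomial in t.\<close>

lemma self_similar_lines_equation: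
  fixes X :: "real \<times> real \<Rightarrow> real^3"
  assumes "open I" "s \<in> I" "\<And>s t. s \<in> I \<Longrightarrow> X (s, t) = t *\<^sub>R g s + p s"
    and dg: "\<And>s. s \<in> I \<Longrightarrow> (g has_vector_derivative g1 s) (at s)"
    and dg1: "\<And>s. s \<in> I \<Longrightarrow> (g1 has_vector_derivative g2 s) (at s)"
    and dp: "\<And>s. s \<in> I \<Longrightarrow> (p has_vector_derivative p1 s) (at s)"
    and dp1: "\<And>s. s \<in> I \<Longrightarrow> (p1 has_vector_derivative p2 s) (at s)"
    and "g s \<bullet> g s = 1"
    and nz: "(t *\<^sub>R g1 s + p1 s) \<times> g s \<noteq> 0"
    and eq: "\<And>N. unit_normal_at X (s, t) N \<Longrightarrow> mean_curvature X (s, t) N + lam * (X (s, t) \<bullet> N) = 0"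
  shows "(t *\<^sub>R g2 s + p2 s) \<bullet> ((t *\<^sub>R g1 s + p1 s) \<times> g s)
         - 2 * (g1 s \<bullet> ((t *\<^sub>R g1 s + p1 s) \<times> g s)) * ((t *\<^sub>R g1 s + p1 s) \<bullet> g s)
         + 2 * lam * (((t *\<^sub>R g1 s + p1 s) \<times> g s) \<bullet> ((t *\<^sub>R g1 s + p1 s) \<times> g s))
           * (p s \<bullet> ((t *\<^sub>R g1 s + p1 s) \<times> g s)) = 0"
proof -
  define a where "a = t *\<^sub>R g1 s + p1 s"
  define n where "n = a \<times> g s"
  have [simp]: "n \<noteq> 0" using nz by (simp add: n_def a_def)
  have Xs: "deriv_s X (s, t) = t *\<^sub>R g1 s + p1 s" if "s \<in> I" for s t
    using lines_deriv(1)[OF assms(1) that assms(3) dg[OF that] dp[OF that]] .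
  \<comment> \<open>The summand \<open>t *\<^sub>R 0\<close> gives X_t the shape of a family of
    lines, as \<open>lines_deriv\<close> expects.\<close>
  have Xt: "deriv_t X (s, t) = t *\<^sub>R 0 + g s" if "s \<in> I" for s t
    using lines_deriv(2)[OF assms(1) that assms(3) dg[OF that] dp[OF that]] by simp
  have Xss: "deriv_s (deriv_s X) (s, t) = t *\<^sub>R g2 s + p2 s" and Xst: "deriv_t (deriv_s X) (s, t) = g1 s"
    using lines_deriv[OF assms(1,2) Xs dg1[OF assms(2)] dp1[OF assms(2)]] by blast+
  have Xtt: "deriv_t (deriv_t X) (s, t) = 0"
    using lines_deriv(2)[OF assms(1,2) Xt has_vector_derivative_const dg[OF assms(2)]] .
  define N where "N = n /\<^sub>R norm n"
  have Ng: "g s \<bullet> n = 0" "a \<bullet> n = 0" by (simp_all add: n_def dot_cross_self)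
  have "unit_normal_at X (s, t) N"
    unfolding unit_normal_at_def Xs[OF assms(2)] Xt[OF assms(2)] a_def[symmetric]
    using Ng by (simp add: N_def inner_commute)
  from eq[OF this] have "((t *\<^sub>R g2 s + p2 s) \<bullet> N - 2 * (g1 s \<bullet> N) * (a \<bullet> g s)) / (2 * (a \<bullet> a - (a \<bullet> g s)\<^sup>2))
     + lam * ((t *\<^sub>R g s + p s) \<bullet> N) = 0"
    unfolding mean_curvature_def Xs[OF assms(2)] Xt[OF assms(2)] Xss Xst Xtt Let_def assms(3)[OF assms(2)]
    using assms by (simp add: a_def)
  moreover have "a \<bullet> a - (a \<bullet> g s)\<^sup>2 = n \<bullet> n"
    using assms by (simp add: n_def dot_cross inner_commute power2_eq_square)
  moreover have "x \<bullet> N = (x \<bullet> n) / norm n" for x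
    by (simp add: N_def divide_inverse)
  moreover have "(t *\<^sub>R g s + p s) \<bullet> n = p s \<bullet> n"
    using Ng by (simp add: inner_simps)
  ultimately have "((t *\<^sub>R g2 s + p2 s) \<bullet> n - 2 * (g1 s \<bullet> n) * (a \<bullet> g s)) / norm n / (2 * (n \<bullet> n))
     + lam * (p s \<bullet> n) / norm n = 0"
    by (simp add: diff_divide_distrib)
  moreover have "L + 2 * lam * m * P = 0" if "L / r / (2 * m) + lam * P / r = 0" "m \<noteq> 0" "r \<noteq> 0"
    for L m P r :: real
  proof -
    have "L + 2 * lam * m * P = 2 * m * r * (L / r / (2 * m) + lam * P / r)"
      using that(2,3) by (simp add: field_simps)
    then show ?thesis using that(1) by simp
  qed
  moreover have "n \<bullet> n \<noteq> 0" "norm n \<noteq> 0" by simp_all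
  ultimately show ?thesis
    unfolding a_def[symmetric] n_def[symmetric] by blast
qed

lemma cross_unit_eq_0:
  fixes a g :: "real^3"
  assumes "a \<times> g = 0" "g \<bullet> g = 1"
  shows "a = (a \<bullet> g) *\<^sub>R g"
  using Lagrange[of g a g] assms by (simp add: inner_commute)

text \<open>A vanishing cross product makes X_s a multiple of the unit vector X_t, and then the
  vector (1, -\<langle>X_s, \<gamma>\<rangle>) lies in the kernel of the derivative.\<close>

lemma immersion_lines_cross_nonzero:
  fixes X :: "real \<times> real \<Rightarrow> real^3"
  assumes "open I" "s \<in> I" "\<And>s t. s \<in> I \<Longrightarrow> X (s, t) = t *\<^sub>R \<gamma> s + p s"
    and "(\<gamma> has_vector_derivative \<gamma>') (at s)" "(p has_vector_derivative p') (at s)"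
    and "\<gamma> s \<bullet> \<gamma> s = 1" and inj: "inj (frechet_derivative X (at (s, t)))"
  shows "(t *\<^sub>R \<gamma>' + p') \<times> \<gamma> s \<noteq> 0"
proof
  assume "(t *\<^sub>R \<gamma>' + p') \<times> \<gamma> s = 0"
  from cross_unit_eq_0[OF this assms(6)]
  have "1 *\<^sub>R (t *\<^sub>R \<gamma>' + p') + (- ((t *\<^sub>R \<gamma>' + p') \<bullet> \<gamma> s)) *\<^sub>R \<gamma> s = 0" by simp
  moreover have "frechet_derivative X (at (s, t)) = (\<lambda>q. fst q *\<^sub>R (t *\<^sub>R \<gamma>' + p') + snd q *\<^sub>R \<gamma> s)"
    using frechet_derivative_at[OF lines_has_derivative[OF assms(1-5)], of t] by simp
  ultimately have "frechet_derivative X (at (s, t)) (1, - ((t *\<^sub>R \<gamma>' + p') \<bullet> \<gamma> s)) = frechet_derivative X (at (s, t)) (0, 0)"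
    by simp
  with inj have "(1, - ((t *\<^sub>R \<gamma>' + p') \<bullet> \<gamma> s)) = (0 :: real, 0 :: real)"
    by (rule injD)
  then show False by simp
qed

unbundle no cross3_syntax

subsection \<open>Smooth immersions\<close>

lemma smooth_on_has_derivative:
  assumes "smooth_on D f" "x \<in> D"
  shows "(f has_derivative frechet_derivative f (at x)) (at x)"
proof -
  have "Ck_on (Suc 0) D f" using assms by (simp add: smooth_on_def del: Ck_on.simps)
  from Ck_on_Suc_has_derivative[OF this assms(2)] show ?thesis .
qed

lemma smooth_immersion_on_cong:
  assumes "smooth_immersion_on D f" "\<And>x. x \<in> D \<Longrightarrow> f x = g x"
  shows "smooth_immersion_on D g"
proof -
  have D: "open D" and f: "smooth_on D f" and inj: "\<And>x. x \<in> D \<Longrightarrow> inj (frechet_derivative f (at x))"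
    using assms(1) by (auto simp: smooth_immersion_on_def)
  have "smooth_on D g"
    using f Ck_on_cong[OF D] assms(2) by (metis smooth_on_def)
  moreover have "frechet_derivative f (at x) = frechet_derivative g (at x)" if "x \<in> D" for x
  proof (rule frechet_derivative_at)
    from smooth_on_has_derivative[OF f that]
    show "(g has_derivative frechet_derivative f (at x)) (at x)"
      by (rule has_derivative_transform_within_open[OF _ D that]) (use assms(2) in auto)
  qed
  ultimately show ?thesis using D inj by (simp add: smooth_immersion_on_def)
qed

lemma smooth_immersion_on_compose_affine:
  assumes "smooth_immersion_on D f" "open D'" "bounded_linear L" "inj L" "\<And>x. x \<in> D' \<Longrightarrow> L x + b \<in> D"
  shows "smooth_immersion_on D' (\<lambda>x. f (L x + b))"
proof -
  have D: "open D" and f: "smooth_on D f" and inj: "\<And>x. x \<in> D \<Longrightarrow> inj (frechet_derivative f (at x))"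
    using assms(1) by (auto simp: smooth_immersion_on_def)
  have "smooth_on D' (\<lambda>x. f (L x + b))"
    using f Ck_on_compose_affine[OF D assms(2,3,5), of _ f] unfolding smooth_on_def by blast
  moreover have "inj (frechet_derivative (\<lambda>x. f (L x + b)) (at x))" if "x \<in> D'" for x
  proof -
    have "((\<lambda>x. L x + b) has_derivative L) (at x)"
      using has_derivative_add[OF bounded_linear_imp_has_derivative[OF assms(3)] has_derivative_const] by fastforce
    from has_derivative_compose[OF this smooth_on_has_derivative[OF f assms(5)[OF that]]]
    have "((\<lambda>x. f (L x + b)) has_derivative (frechet_derivative f (at (L x + b)) \<circ> L)) (at x)"
      by (simp add: o_def)
    from frechet_derivative_at[OF this, symmetric]
    have "frechet_derivative (\<lambda>x. f (L x + b)) (at x) = frechet_derivative f (at (L x + b)) \<circ> L" .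
    then show ?thesis using inj_compose[OF inj[OF assms(5)[OF that]] assms(4)] by simp
  qed
  ultimately show ?thesis using assms(2) by (simp add: smooth_immersion_on_def)
qed

lemma smooth_immersion_on_curve_derivatives:
  fixes c :: "real \<Rightarrow> 'e::real_normed_vector"
  assumes "smooth_immersion_on D c"
  obtains c1 c2 where
    "\<And>s. s \<in> D \<Longrightarrow> (c has_vector_derivative c1 s) (at s)"
    "\<And>s. s \<in> D \<Longrightarrow> (c1 has_vector_derivative c2 s) (at s)"
    "\<And>s. s \<in> D \<Longrightarrow> c1 s \<noteq> 0"
proof -
  from assms have c: "Ck_on 2 D c" by (auto simp: smooth_immersion_on_def smooth_on_def)
  from Ck_on_real_vector_derivatives[OF this] obtain c1 c2 where c12:
    "\<And>s. s \<in> D \<Longrightarrow> (c has_vector_derivative c1 s) (at s)"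
    "\<And>s. s \<in> D \<Longrightarrow> (c1 has_vector_derivative c2 s) (at s)" by blast
  have "c1 s \<noteq> 0" if "s \<in> D" for s
  proof
    assume "c1 s = 0"
    then have "frechet_derivative c (at s) = (\<lambda>h. 0)"
      using c12(1)[OF that] frechet_derivative_at unfolding has_vector_derivative_def by fastforce
    moreover have "inj (frechet_derivative c (at s))" using assms that by (simp add: smooth_immersion_on_def)
    ultimately have "(0::real) = 1" by (auto simp: inj_def)
    then show False by simp
  qed
  with c12 that show ?thesis by blast
qed

text \<open>Differentiating \<langle>c, v\<rangle> = 0 shows that c' is orthogonal to v. Both are
  nonzero, so the two partial derivatives are independent.\<close>

lemma smooth_immersion_on_cylinder:
  fixes c :: "real \<Rightarrow> real^3"
  assumes c: "smooth_immersion_on D c" and v: "v \<noteq> 0" "\<And>s. s \<in> D \<Longrightarrow> c s \<bullet> v = 0"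
  shows "smooth_immersion_on (D \<times> (UNIV :: real set)) (\<lambda>(s, t). t *\<^sub>R v + c s)"
  unfolding smooth_immersion_on_def
proof (intro conjI ballI)
  from c have D: "open D" and "smooth_on D c" by (auto simp: smooth_immersion_on_def)
  then show "open (D \<times> (UNIV :: real set))" "smooth_on (D \<times> (UNIV :: real set)) (\<lambda>(s, t). t *\<^sub>R v + c s)"
    by (simp_all add: open_Times smooth_on_cylinder)
  obtain c1 c2 where c12: "\<And>s. s \<in> D \<Longrightarrow> (c has_vector_derivative c1 s) (at s)" and nz: "\<And>s. s \<in> D \<Longrightarrow> c1 s \<noteq> 0"
    using smooth_immersion_on_curve_derivatives[OF c] by metis
  fix q assume "q \<in> D \<times> (UNIV :: real set)"
  then obtain s t where q: "q = (s, t)" and s: "s \<in> D" by auto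
  have "c1 s \<bullet> v = 0"
    using has_derivative_const_on_open[OF D s v(2) has_real_derivative_inner[OF c12[OF s] has_vector_derivative_const]]
    by simp
  have "((\<lambda>(s, t). t *\<^sub>R v + c s) has_derivative (\<lambda>q. fst q *\<^sub>R (t *\<^sub>R 0 + c1 s) + snd q *\<^sub>R v)) (at (s, t))"
    by (rule lines_has_derivative[OF D s _ has_vector_derivative_const c12[OF s]]) simp
  then have F: "frechet_derivative (\<lambda>(s, t). t *\<^sub>R v + c s) (at q) = (\<lambda>q. fst q *\<^sub>R c1 s + snd q *\<^sub>R v)"
    using frechet_derivative_at q by fastforce
  have "x = 0 \<and> y = 0" if "x *\<^sub>R c1 s + y *\<^sub>R v = 0" for x y :: real
  proof -
    have "(x *\<^sub>R c1 s + y *\<^sub>R v) \<bullet> v = 0" using that by simp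
    then have "y = 0" using v(1) \<open>c1 s \<bullet> v = 0\<close> by (simp add: inner_simps)
    then show ?thesis using that nz[OF s] by simp
  qed
  then have zero: "x = 0 \<and> y = 0" if "fst (x, y) *\<^sub>R c1 s + snd (x, y) *\<^sub>R v = 0" for x y :: real
    using that by simp
  have "linear (\<lambda>q::real \<times> real. fst q *\<^sub>R c1 s + snd q *\<^sub>R v)"
    by (intro linearI) (auto simp: algebra_simps)
  then show "inj (frechet_derivative (\<lambda>(s, t). t *\<^sub>R v + c s) (at q))"
    unfolding F using zero by (subst linear_injective_0) (auto simp: zero_prod_def)
qed

section \<open>Self-similar charts: constant rulings, and the curve equation of a cylinder\<close>

lemma open_fst_Times_UNIV:
  assumes "open (I \<times> (UNIV :: 'b::topological_space set))"
  shows "open I"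
  using open_image_fst[OF assms] by (simp add: fst_image_times)

text \<open>Collects the preceding facts for one chart: smoothness of \<gamma> and p, the
  nonvanishing normal and the polynomial equation give \<gamma>' = 0, and \<open>I\<close> is an
  interval.\<close>

lemma self_similar_ruled_chart_direction_constant:
  fixes I :: "real set"
  assumes lam: "lam \<noteq> 0" and "self_similar_surface lam S \<Phi>" and I: "is_interval I"
    and chart: "local_parametrization S \<Phi> (I \<times> (UNIV :: real set)) h"
    and unit: "\<And>s. s \<in> I \<Longrightarrow> norm (\<gamma> s) = 1" and orth: "\<And>s. s \<in> I \<Longrightarrow> p s \<bullet> \<gamma> s = 0"
    and lines: "\<And>s t. s \<in> I \<Longrightarrow> \<Phi> (h (s, t)) = t *\<^sub>R \<gamma> s + p s"
  obtains w where "\<And>s. s \<in> I \<Longrightarrow> \<gamma> s = w"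
proof -
  let ?X = "\<Phi> \<circ> h"
  have X: "smooth_immersion_on (I \<times> (UNIV :: real set)) ?X"
    using chart by (simp add: local_parametrization_def)
  then have opn: "open I" and smooth: "smooth_on (I \<times> UNIV) ?X"
    and inj: "\<And>s t. s \<in> I \<Longrightarrow> inj (frechet_derivative ?X (at (s, t)))"
    by (auto simp: smooth_immersion_on_def intro: open_fst_Times_UNIV)
  have eqX: "?X (s, t) = t *\<^sub>R \<gamma> s + p s" if "s \<in> I" for s t using lines that by simp
  have "Ck_on 2 I \<gamma>" "Ck_on 2 I p"
    using smooth_on_lines[OF opn smooth eqX] by (simp_all add: smooth_on_def)
  then obtain g1 g2 p1 p2 where d:
    "\<And>s. s \<in> I \<Longrightarrow> (\<gamma> has_vector_derivative g1 s) (at s)"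
    "\<And>s. s \<in> I \<Longrightarrow> (g1 has_vector_derivative g2 s) (at s)"
    "\<And>s. s \<in> I \<Longrightarrow> (p has_vector_derivative p1 s) (at s)"
    "\<And>s. s \<in> I \<Longrightarrow> (p1 has_vector_derivative p2 s) (at s)"
    using Ck_on_real_vector_derivatives by metis
  have unit': "\<gamma> s \<bullet> \<gamma> s = 1" if "s \<in> I" for s
    using unit[OF that] by (simp add: norm_eq_1)
  have nz: "cross3 (t *\<^sub>R g1 s + p1 s) (\<gamma> s) \<noteq> 0" if "s \<in> I" for s t
    by (rule immersion_lines_cross_nonzero[OF opn that eqX d(1)[OF that] d(3)[OF that] unit'[OF that] inj[OF that]])
  have "g1 s = 0" if "s \<in> I" for s
  proof (rule ruling_direction_stationary[OF opn d unit' orth lam nz _ that])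
    fix s t assume s: "s \<in> I"
    show "(t *\<^sub>R g2 s + p2 s) \<bullet> (cross3 (t *\<^sub>R g1 s + p1 s) (\<gamma> s))
         - 2 * (g1 s \<bullet> (cross3 (t *\<^sub>R g1 s + p1 s) (\<gamma> s))) * ((t *\<^sub>R g1 s + p1 s) \<bullet> \<gamma> s)
         + 2 * lam * ((cross3 (t *\<^sub>R g1 s + p1 s) (\<gamma> s)) \<bullet> (cross3 (t *\<^sub>R g1 s + p1 s) (\<gamma> s)))
           * (p s \<bullet> (cross3 (t *\<^sub>R g1 s + p1 s) (\<gamma> s))) = 0"
    proof (rule self_similar_lines_equation[OF opn s eqX d unit'[OF s] nz[OF s]])
      show "mean_curvature ?X (s, t) N + lam * (?X (s, t) \<bullet> N) = 0" if "unit_normal_at ?X (s, t) N" for N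
        using assms(2) chart s that unfolding self_similar_surface_def by force
    qed
  qed
  then have "(\<gamma> has_vector_derivative 0) (at s within I)" if "s \<in> I" for s
    using d(1)[OF that] that by (auto intro: has_vector_derivative_at_within)
  then show ?thesis
    using has_vector_derivative_zero_constant[of I \<gamma>] I that by (metis is_interval_convex)
qed

text \<open>The left-hand side W is orthogonal to v, because c and its derivatives are, and to c',
  because curvature vector and normal position are normal to the curve. So only its component along
  n = c' \<times> v is in question, and that vanishes by the surface equation at t = 0.\<close>

lemma self_similar_cylinder_generator:
  fixes c :: "real \<Rightarrow> real^3" and X :: "real \<times> real \<Rightarrow> real^3"
  assumes c: "smooth_immersion_on D c" and cv: "\<And>s. s \<in> D \<Longrightarrow> c s \<bullet> v = 0" and v: "norm v = 1"
    and X: "\<And>s t. s \<in> D \<Longrightarrow> X (s, t) = t *\<^sub>R v + c s"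
    and eq: "\<And>N. unit_normal_at X (s, 0) N \<Longrightarrow> mean_curvature X (s, 0) N + lam * (X (s, 0) \<bullet> N) = 0"
    and s: "s \<in> D"
  shows "curvature_vector c s + (2 * lam) *\<^sub>R normal_position c s = 0"
proof -
  have D: "open D" using c by (simp add: smooth_immersion_on_def)
  obtain c1 c2 where d: "\<And>s. s \<in> D \<Longrightarrow> (c has_vector_derivative c1 s) (at s)"
    "\<And>s. s \<in> D \<Longrightarrow> (c1 has_vector_derivative c2 s) (at s)"
    and nz: "\<And>s. s \<in> D \<Longrightarrow> c1 s \<noteq> 0"
    using smooth_immersion_on_curve_derivatives[OF c] by metis
  have vv: "v \<bullet> v = 1" using v by (simp add: norm_eq_1)
  have c1v: "c1 s \<bullet> v = 0" if "s \<in> D" for s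
    using has_derivative_const_on_open[OF D that cv has_real_derivative_inner[OF d(1)[OF that] has_vector_derivative_const]]
    by simp
  have c2v: "c2 s \<bullet> v = 0" if "s \<in> D" for s
    using has_derivative_const_on_open[OF D that c1v has_real_derivative_inner[OF d(2)[OF that] has_vector_derivative_const]]
    by simp
  define n where "n = cross3 (c1 s) v"
  define m where "m = c1 s \<bullet> c1 s"
  have m: "m > 0" using nz[OF s] by (simp add: m_def)
  have nn: "n \<bullet> n = m" using vv c1v[OF s] by (simp add: n_def m_def dot_cross inner_commute)
  have nc1: "c1 s \<bullet> n = 0" by (simp add: n_def dot_cross_self)
  \<comment> \<open>Written as the normal of a family of lines at t = 0 with constant direction, to
    fit the hypothesis of \<open>self_similar_lines_equation\<close>.\<close>
  have "cross3 (0 *\<^sub>R 0 + c1 s) v \<noteq> 0" using nn m unfolding n_def by auto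
  from self_similar_lines_equation[OF D s X has_vector_derivative_const has_vector_derivative_const d vv this eq]
  have main: "c2 s \<bullet> n + 2 * lam * m * (c s \<bullet> n) = 0"
    by (simp add: n_def[symmetric] nn)
  have vel: "velocity c x = c1 x" if "x \<in> D" for x
    unfolding velocity_def using d(1)[OF that] by (rule vector_derivative_at)
  have T: "unit_tangent c x = c1 x /\<^sub>R norm (c1 x)" if "x \<in> D" for x
    using vel[OF that] by (simp add: unit_tangent_def)
  \<comment> \<open>\<open>r\<close> is the reciprocal speed. Its derivative \<open>r'\<close> need
    not be computed: it multiplies \<open>c1 s\<close>, which is orthogonal to \<open>n\<close>, and
    the component along \<open>c1 s\<close> is settled by the constant length of the unit
    tangent.\<close>
  define r where "r x = inverse (norm (c1 x))" for x
  have "(\<lambda>x. norm (c1 x)) differentiable (at s)"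
    using differentiable_compose[of norm c1 s UNIV] differentiable_norm_at[OF nz[OF s]] d(2)[OF s]
    by (metis differentiableI_vector)
  then have "r differentiable (at s)"
    unfolding r_def using nz[OF s] by (intro differentiable_inverse) simp_all
  then obtain r' where r': "(r has_vector_derivative r') (at s)"
    using vector_derivative_works by blast
  have "((\<lambda>x. r x *\<^sub>R c1 x) has_vector_derivative (r s *\<^sub>R c2 s + r' *\<^sub>R c1 s)) (at s)"
    using r' d(2)[OF s] by (intro has_vector_derivative_scaleR) (simp_all add: has_real_derivative_iff_has_vector_derivative)
  then have T': "(unit_tangent c has_vector_derivative (r s *\<^sub>R c2 s + r' *\<^sub>R c1 s)) (at s)"
    by (rule has_vector_derivative_transform_within_open[OF _ D s]) (simp add: r_def T)
  have "unit_tangent c x \<bullet> unit_tangent c x = 1" if "x \<in> D" for x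
    using nz[OF that] unfolding T[OF that] by (simp add: dot_square_norm power2_eq_square)
  from has_derivative_const_on_open[OF D s this has_real_derivative_inner[OF T' T']]
  have T'T: "(r s *\<^sub>R c2 s + r' *\<^sub>R c1 s) \<bullet> c1 s = 0"
    using nz[OF s] unfolding T[OF s] by (simp add: inner_commute)
  have rm: "r s * r s * m = 1"
    using nz[OF s] by (simp add: r_def m_def dot_square_norm power2_eq_square field_simps)
  define K where "K = curvature_vector c s"
  define P where "P = normal_position c s"
  have K: "K = r s *\<^sub>R (r s *\<^sub>R c2 s + r' *\<^sub>R c1 s)"
    using vector_derivative_at[OF T'] vel[OF s] unfolding K_def curvature_vector_def r_def
    by (simp add: velocity_def)
  have P: "P = c s - (r s * r s * (c s \<bullet> c1 s)) *\<^sub>R c1 s"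
    unfolding P_def normal_position_def T[OF s] r_def by simp
  define W where "W = K + (2 * lam) *\<^sub>R P"
  have "P \<bullet> c1 s = 0"
    using rm unfolding P m_def by (simp add: inner_simps)
  then have Wc: "W \<bullet> c1 s = 0" using T'T by (simp add: W_def K inner_simps)
  have Wv: "W \<bullet> v = 0"
    using c1v[OF s] c2v[OF s] cv[OF s] by (simp add: W_def K P inner_simps)
  have "m * (W \<bullet> n) = m * (r s * r s * (c2 s \<bullet> n) + 2 * lam * (c s \<bullet> n))"
    using nc1 by (simp add: W_def K P inner_simps)
  also have "\<dots> = (r s * r s * m) * (c2 s \<bullet> n) + 2 * lam * m * (c s \<bullet> n)" by (simp add: algebra_simps)
  also have "\<dots> = 0" using main by (simp add: rm)
  finally have Wn: "W \<bullet> n = 0" using m by simp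
  have "m *\<^sub>R W = 0"
    using cross3_frame_expansion_orthonormal[OF vv, of "c1 s" W] Wc Wv Wn c1v[OF s]
    by (simp add: n_def m_def inner_commute)
  then show ?thesis using m by (simp add: W_def K_def P_def)
qed

subsection \<open>The common direction of the rulings\<close>

text \<open>The conditions that \<open>ruled_surface\<close> puts on a chart, apart from covering a
  given point, with the foliation as a parameter.\<close>

definition ruled_chart ::
  "'a topology \<Rightarrow> ('a \<Rightarrow> real^3) \<Rightarrow> 'a set set \<Rightarrow> real set \<Rightarrow> (real \<times> real \<Rightarrow> 'a) \<Rightarrow> (real \<Rightarrow> real^3) \<Rightarrow> (real \<Rightarrow> real^3) \<Rightarrow> bool"
where
  "ruled_chart S \<Phi> L I h \<gamma> p \<longleftrightarrow>
     is_interval I \<and> local_parametrization S \<Phi> (I \<times> (UNIV :: real set)) h \<and>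
     (\<forall>s\<in>I. norm (\<gamma> s) = 1 \<and> p s \<bullet> \<gamma> s = 0) \<and>
     (\<forall>s\<in>I. \<forall>t. \<Phi> (h (s, t)) = t *\<^sub>R \<gamma> s + p s) \<and>
     (\<forall>s\<in>I. h ` ({s} \<times> UNIV) \<in> L)"

text \<open>Leaves with a common point coincide. The points with parameters 0 and 1 on the leaf in
  one chart thus lie on the line of the other chart, so their difference \<gamma> s is a multiple of
  \<gamma>' s'; both are unit vectors.\<close>

lemma ruled_charts_parallel:
  assumes L: "partition_on (topspace S) L"
    and 1: "ruled_chart S \<Phi> L I h \<gamma> p" and 2: "ruled_chart S \<Phi> L I' h' \<gamma>' p'"
    and s: "s \<in> I" "s' \<in> I'" and eq: "h (s, t) = h' (s', t')"
  shows "\<gamma> s = \<gamma>' s' \<or> \<gamma> s = - \<gamma>' s'"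
proof -
  have "h ` ({s} \<times> UNIV) \<in> L" "h' ` ({s'} \<times> UNIV) \<in> L"
    using 1 2 s by (auto simp: ruled_chart_def)
  note disjoint = disjointD[OF partition_onD2[OF L] this]
  have "h (s, t) \<in> h ` ({s} \<times> UNIV) \<inter> h' ` ({s'} \<times> UNIV)"
    using eq by (metis IntI SigmaI UNIV_I imageI insertI1)
  then have leaf: "h ` ({s} \<times> UNIV) = h' ` ({s'} \<times> UNIV)"
    using disjoint by (metis emptyE)
  have "h (s, 0) \<in> h' ` ({s'} \<times> UNIV)" "h (s, 1) \<in> h' ` ({s'} \<times> UNIV)"
    unfolding leaf[symmetric] by auto
  then obtain r0 r1 where "h (s, 0) = h' (s', r0)" "h (s, 1) = h' (s', r1)" by auto
  then have "p s = r0 *\<^sub>R \<gamma>' s' + p' s'" "\<gamma> s + p s = r1 *\<^sub>R \<gamma>' s' + p' s'"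
    using 1 2 s unfolding ruled_chart_def by (metis add.left_neutral scaleR_one scaleR_zero_left)+
  then have g: "\<gamma> s = (r1 - r0) *\<^sub>R \<gamma>' s'" by (simp add: algebra_simps)
  have "norm (\<gamma> s) = 1" "norm (\<gamma>' s') = 1" using 1 2 s by (auto simp: ruled_chart_def)
  with g have "\<bar>r1 - r0\<bar> = 1" by simp
  then have "r1 - r0 = 1 \<or> r1 - r0 = -1" by linarith
  then show ?thesis unfolding g by (metis scaleR_minus1_left scaleR_one)
qed

text \<open>Fix the direction v of one chart. The points covered by a chart of direction v or -v
  form an open set. Its complement is open too, since by \<open>ruled_charts_parallel\<close> a
  chart meeting the set has direction v or -v itself. Connectedness concludes. The sign \<epsilon>
  remains because charts may run along the leaves in opposite senses.\<close>

lemma self_similar_ruled_surface_common_direction: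
  assumes lam: "lam \<noteq> 0" and self_similar: "self_similar_surface lam S \<Phi>"
    and L: "partition_on (topspace S) L"
    and charts: "\<And>x. x \<in> topspace S \<Longrightarrow> \<exists>I h \<gamma> p. ruled_chart S \<Phi> L I h \<gamma> p \<and> x \<in> h ` (I \<times> UNIV)"
    and nonempty: "topspace S \<noteq> {}"
  obtains v where "norm v = 1"
    "\<And>x. x \<in> topspace S \<Longrightarrow> \<exists>I h \<epsilon> p. (\<epsilon> = 1 \<or> \<epsilon> = -1) \<and>
       ruled_chart S \<Phi> L I h (\<lambda>_. \<epsilon> *\<^sub>R v) p \<and> x \<in> h ` (I \<times> UNIV)"
proof -
  have charts': "\<exists>I h w p. norm w = 1 \<and> ruled_chart S \<Phi> L I h (\<lambda>_. w) p \<and> x \<in> h ` (I \<times> UNIV)"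
    if x: "x \<in> topspace S" for x
  proof -
    obtain I h \<gamma> p where c: "ruled_chart S \<Phi> L I h \<gamma> p" "x \<in> h ` (I \<times> UNIV)" using charts[OF x] by blast
    then obtain w where w: "\<And>s. s \<in> I \<Longrightarrow> \<gamma> s = w"
      using self_similar_ruled_chart_direction_constant[OF lam self_similar, of I h \<gamma> p]
      unfolding ruled_chart_def by blast
    have "ruled_chart S \<Phi> L I h (\<lambda>_. w) p" "norm w = 1"
      using c w unfolding ruled_chart_def by auto
    with c(2) show ?thesis by blast
  qed
  have opn: "openin S (h ` (I \<times> UNIV))" if "ruled_chart S \<Phi> L I h \<gamma> p" for I h \<gamma> p
    using that by (simp add: ruled_chart_def local_parametrization_def)
  obtain x0 where x0: "x0 \<in> topspace S" using nonempty by blast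
  obtain I0 h0 v p0 where v: "norm v = 1" and c0: "ruled_chart S \<Phi> L I0 h0 (\<lambda>_. v) p0" "x0 \<in> h0 ` (I0 \<times> UNIV)"
    using charts'[OF x0] by blast
  define Q where "Q x \<longleftrightarrow> (\<exists>I h w p. (w = v \<or> w = -v) \<and> ruled_chart S \<Phi> L I h (\<lambda>_. w) p \<and> x \<in> h ` (I \<times> UNIV))" for x
  define A where "A = {x \<in> topspace S. Q x}"
  have "openin S A"
  proof (subst openin_subopen, intro ballI)
    fix x assume "x \<in> A"
    then obtain I h w p where w: "w = v \<or> w = -v" and c: "ruled_chart S \<Phi> L I h (\<lambda>_. w) p" and x: "x \<in> h ` (I \<times> UNIV)"
      unfolding A_def Q_def by blast
    have "h ` (I \<times> UNIV) \<subseteq> A"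
      using openin_subset[OF opn[OF c]] w c unfolding A_def Q_def by blast
    then show "\<exists>T. openin S T \<and> x \<in> T \<and> T \<subseteq> A" using opn[OF c] x by blast
  qed
  moreover have "openin S (topspace S - A)"
  proof (subst openin_subopen, intro ballI)
    fix x assume x: "x \<in> topspace S - A"
    then obtain I h w p where c: "ruled_chart S \<Phi> L I h (\<lambda>_. w) p" "x \<in> h ` (I \<times> UNIV)"
      using charts' by blast
    have "y \<notin> A" if "y \<in> h ` (I \<times> UNIV)" for y
    proof
      assume "y \<in> A"
      then obtain I' h' w' p' where w': "w' = v \<or> w' = -v" and c': "ruled_chart S \<Phi> L I' h' (\<lambda>_. w') p'" and y: "y \<in> h' ` (I' \<times> UNIV)"
        unfolding A_def Q_def by blast
      from that y obtain s t s' t' where "s \<in> I" "s' \<in> I'" "h (s, t) = h' (s', t')" by auto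
      from ruled_charts_parallel[OF L c(1) c' this] w' have "w = v \<or> w = -v" by auto
      then have "x \<in> A" using c x unfolding A_def Q_def by blast
      then show False using x by blast
    qed
    then have "h ` (I \<times> UNIV) \<subseteq> topspace S - A"
      using openin_subset[OF opn[OF c(1)]] by blast
    then show "\<exists>T. openin S T \<and> x \<in> T \<and> T \<subseteq> topspace S - A" using opn[OF c(1)] c(2) by blast
  qed
  then have "closedin S A" by (simp add: closedin_def A_def)
  moreover have "connected_space S" using self_similar by (simp add: self_similar_surface_def immersed_surface_def)
  moreover have "x0 \<in> A" using x0 c0 unfolding A_def Q_def by blast
  ultimately have "A = topspace S" unfolding connected_space_clopen_in by blast
  have "\<exists>I h \<epsilon> p. (\<epsilon> = 1 \<or> \<epsilon> = -1) \<and> ruled_chart S \<Phi> L I h (\<lambda>_. \<epsilon> *\<^sub>R v) p \<and> x \<in> h ` (I \<times> UNIV)"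
    if "x \<in> topspace S" for x
  proof -
    have "Q x" using that \<open>A = topspace S\<close> unfolding A_def by blast
    then obtain I h w p where w: "w = v \<or> w = -v" and c: "ruled_chart S \<Phi> L I h (\<lambda>_. w) p" "x \<in> h ` (I \<times> UNIV)"
      unfolding Q_def by blast
    from w obtain \<epsilon> :: real where "\<epsilon> = 1 \<or> \<epsilon> = -1" "w = \<epsilon> *\<^sub>R v"
      by (metis scaleR_minus1_left scaleR_one)
    with c show ?thesis by blast
  qed
  with v show ?thesis by (rule that)
qed

subsection \<open>Surfaces foliated by parallel lines\<close>

lemma continuous_map_local:
  assumes "\<And>x. x \<in> topspace X \<Longrightarrow> \<exists>U. openin X U \<and> x \<in> U \<and> continuous_map (subtopology X U) Y f"
  shows "continuous_map X Y f"
  by (rule pasting_lemma[where I = "{U. openin X U \<and> continuous_map (subtopology X U) Y f}" and T = id and f = "\<lambda>_. f"])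
    (use assms in auto)

lemma embedding_map_prod_UNIV:
  assumes "embedding_map X Y f"
  shows "embedding_map (prod_topology X Z) (prod_topology Y Z) (\<lambda>(x, z). (f x, z))"
proof -
  have "homeomorphic_map X (subtopology Y (f ` topspace X)) f" using assms by (simp add: embedding_map_def)
  then obtain g where "homeomorphic_maps X (subtopology Y (f ` topspace X)) f g"
    unfolding homeomorphic_map_maps by blast
  moreover have "homeomorphic_maps Z Z (\<lambda>z. z) (\<lambda>z. z)" by (simp add: homeomorphic_maps_def)
  ultimately have "homeomorphic_maps (prod_topology X Z) (prod_topology (subtopology Y (f ` topspace X)) Z)
       (\<lambda>(x, z). (f x, z)) (\<lambda>(x, z). (g x, z))"
    using homeomorphic_maps_prod[of X Z "subtopology Y (f ` topspace X)" Z f "\<lambda>z. z" g "\<lambda>z. z"] by blast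
  moreover have "(\<lambda>(x, z). (f x, z)) ` topspace (prod_topology X Z) = f ` topspace X \<times> topspace Z"
    by force
  ultimately show ?thesis
    unfolding embedding_map_def homeomorphic_map_maps by (auto simp: prod_topology_subtopology)
qed

lemma prod_top_of_set_euclidean: "prod_topology (top_of_set A) euclidean = top_of_set (A \<times> UNIV)"
  using prod_topology_subtopology_eu[of A UNIV] by simp

section \<open>Sliding along the leaves to the cross-section orthogonal to the rulings\<close>

locale parallel_ruling =
  fixes S :: "'a topology" and \<Phi> :: "'a \<Rightarrow> real^3" and L :: "'a set set" and v :: "real^3"
  assumes surface: "immersed_surface S \<Phi>"
    and leaves: "partition_on (topspace S) L"
    and unit: "norm v = 1"
    and charts: "x \<in> topspace S \<Longrightarrow> \<exists>I h \<epsilon> p. (\<epsilon> = 1 \<or> \<epsilon> = -1) \<and>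
       ruled_chart S \<Phi> L I h (\<lambda>_. \<epsilon> *\<^sub>R v) p \<and> x \<in> h ` (I \<times> UNIV)"
begin

text \<open>Well defined for \<open>x\<close> in \<open>S\<close>: in a chart of direction
  \<epsilon> v the height \<langle>\<Phi>, v\<rangle> of \<open>h (s, r)\<close> is \<epsilon> r, so
  a leaf has exactly one point of each height.\<close>

definition slide :: "'a \<Rightarrow> real \<Rightarrow> 'a" where
  "slide x t = (THE y. (\<exists>l\<in>L. x \<in> l \<and> y \<in> l) \<and> \<Phi> y \<bullet> v = t)"

text \<open>A model of the leaf space inside \<open>S\<close>. The generating curve thereby keeps
  the type of \<open>S\<close>, and \<Phi> itself serves as its map into space.\<close>

definition transversal :: "'a topology" where
  "transversal = subtopology S {x. \<Phi> x \<bullet> v = 0}"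

lemma v_inner_self: "v \<bullet> v = 1" using unit by (simp add: norm_eq_1)

text \<open>The partition property makes the chart line the only leaf through
  \<open>h (s, r)\<close>, and \<epsilon>^2 = 1 solves for the parameter of height \<open>t\<close>.
  In charts, sliding just resets the second coordinate; the later facts about \<open>slide\<close>
  rest on this.\<close>

lemma
  assumes "ruled_chart S \<Phi> L I h (\<lambda>_. \<epsilon> *\<^sub>R v) p" "\<epsilon> = 1 \<or> \<epsilon> = -1" "s \<in> I"
  shows chart_height: "\<Phi> (h (s, r)) \<bullet> v = \<epsilon> * r"
    and slide_chart: "slide (h (s, r)) t = h (s, \<epsilon> * t)"
proof -
  have p: "p s \<bullet> v = 0" using assms by (auto simp: ruled_chart_def)
  show height: "\<Phi> (h (s, r)) \<bullet> v = \<epsilon> * r" for r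
    using assms p v_inner_self by (auto simp: ruled_chart_def inner_simps)
  have leaf: "h ` ({s} \<times> UNIV) \<in> L" using assms by (simp add: ruled_chart_def)
  have \<epsilon>: "\<epsilon> * \<epsilon> = 1" using assms(2) by auto
  show "slide (h (s, r)) t = h (s, \<epsilon> * t)"
    unfolding slide_def
  proof (rule the_equality)
    show "(\<exists>l\<in>L. h (s, r) \<in> l \<and> h (s, \<epsilon> * t) \<in> l) \<and> \<Phi> (h (s, \<epsilon> * t)) \<bullet> v = t"
      using leaf \<epsilon> by (auto simp: height mult.assoc[symmetric] intro!: bexI[OF _ leaf])
    fix y assume y: "(\<exists>l\<in>L. h (s, r) \<in> l \<and> y \<in> l) \<and> \<Phi> y \<bullet> v = t"
    then obtain l where l: "l \<in> L" "h (s, r) \<in> l" "y \<in> l" by blast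
    have "h (s, r) \<in> h ` ({s} \<times> UNIV)" by auto
    with l(2) disjointD[OF partition_onD2[OF leaves] l(1) leaf] have "l = h ` ({s} \<times> UNIV)"
      by blast
    then obtain r' where r': "y = h (s, r')" using l by auto
    then have "r' = \<epsilon> * t" using y r' height[of r'] assms(2) by auto
    then show "y = h (s, \<epsilon> * t)" using r' by simp
  qed
qed

lemma chart_openin: "ruled_chart S \<Phi> L I h \<gamma> p \<Longrightarrow> openin S (h ` (I \<times> UNIV))"
  by (simp add: ruled_chart_def local_parametrization_def)

lemma chart_point:
  assumes "x \<in> topspace S"
  obtains I h \<epsilon> p s r where "\<epsilon> = 1 \<or> \<epsilon> = -1" "ruled_chart S \<Phi> L I h (\<lambda>_. \<epsilon> *\<^sub>R v) p" "s \<in> I" "x = h (s, r)"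
proof -
  obtain I h \<epsilon> p where c: "\<epsilon> = 1 \<or> \<epsilon> = -1" "ruled_chart S \<Phi> L I h (\<lambda>_. \<epsilon> *\<^sub>R v) p"
    and "x \<in> h ` (I \<times> UNIV)"
    using charts[OF assms] by blast
  then obtain s r where "s \<in> I" "x = h (s, r)" by auto
  with c show ?thesis by (rule that)
qed

lemma
  assumes x: "x \<in> topspace S"
  shows slide_in: "slide x t \<in> topspace S"
    and height_slide: "\<Phi> (slide x t) \<bullet> v = t"
    and slide_slide: "slide (slide x r) t = slide x t"
    and slide_height: "slide x (\<Phi> x \<bullet> v) = x"
    and \<Phi>_slide: "\<Phi> (slide x t) = \<Phi> x + (t - \<Phi> x \<bullet> v) *\<^sub>R v"
proof -
  obtain I h \<epsilon> p s u where \<epsilon>: "\<epsilon> = 1 \<or> \<epsilon> = -1" and c: "ruled_chart S \<Phi> L I h (\<lambda>_. \<epsilon> *\<^sub>R v) p"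
    and s: "s \<in> I" "x = h (s, u)"
    by (rule chart_point[OF x])
  have \<epsilon>2: "\<epsilon> * (\<epsilon> * t) = t" for t using \<epsilon> by auto
  note [simp] = slide_chart[OF c \<epsilon> s(1)] chart_height[OF c \<epsilon> s(1)]
  show "slide x t \<in> topspace S"
    using openin_subset[OF chart_openin[OF c]] s by auto
  show "\<Phi> (slide x t) \<bullet> v = t" "slide (slide x r) t = slide x t" "slide x (\<Phi> x \<bullet> v) = x"
    by (simp_all add: s \<epsilon>2)
  show "\<Phi> (slide x t) = \<Phi> x + (t - \<Phi> x \<bullet> v) *\<^sub>R v"
  proof -
    have "\<Phi> (h (s, r)) = (r * \<epsilon>) *\<^sub>R v + p s" for r
      using c s by (simp add: ruled_chart_def)
    moreover have "p s \<bullet> v = 0" using c \<epsilon> s by (auto simp: ruled_chart_def)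
    ultimately show ?thesis using \<epsilon> s v_inner_self by (auto simp: algebra_simps)
  qed
qed

text \<open>The two coordinates are kept apart: continuity of \<open>slide\<close> uses the first,
  continuity of the height the second.\<close>

lemma chart_inverse:
  assumes c: "ruled_chart S \<Phi> L I h \<gamma> p"
  obtains g where "continuous_map (top_of_set (I \<times> UNIV)) S h"
    "continuous_map (subtopology S (h ` (I \<times> UNIV))) (top_of_set I) (fst \<circ> g)"
    "continuous_map (subtopology S (h ` (I \<times> UNIV))) euclideanreal (snd \<circ> g)"
    "\<And>s t. s \<in> I \<Longrightarrow> g (h (s, t)) = (s, t)"
proof -
  have "embedding_map (top_of_set (I \<times> UNIV)) S h" using c by (simp add: ruled_chart_def local_parametrization_def)
  then obtain g where g: "homeomorphic_maps (top_of_set (I \<times> UNIV)) (subtopology S (h ` (I \<times> UNIV))) h g"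
    unfolding embedding_map_def homeomorphic_map_maps by auto
  then have h: "continuous_map (top_of_set (I \<times> UNIV)) S h"
    and "continuous_map (subtopology S (h ` (I \<times> UNIV))) (prod_topology (top_of_set I) euclidean) g"
    and "\<And>s t. s \<in> I \<Longrightarrow> g (h (s, t)) = (s, t)"
    unfolding homeomorphic_maps_def prod_top_of_set_euclidean by (auto dest: continuous_map_into_fulltopology)
  then show ?thesis using that unfolding continuous_map_pairwise by auto
qed

text \<open>Near \<open>x\<close> the map is \<open>h\<close> applied to the first chart coordinate
  and \<epsilon> t, a composite of continuous maps.\<close>

lemma continuous_map_slide: "continuous_map (prod_topology S euclideanreal) S (\<lambda>(x, t). slide x t)"
proof (rule continuous_map_local)
  fix q assume "q \<in> topspace (prod_topology S euclideanreal)"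
  then obtain x t where q: "q = (x, t)" and x: "x \<in> topspace S" by auto
  obtain I h \<epsilon> p where \<epsilon>: "\<epsilon> = 1 \<or> \<epsilon> = -1" and c: "ruled_chart S \<Phi> L I h (\<lambda>_. \<epsilon> *\<^sub>R v) p"
    and xh: "x \<in> h ` (I \<times> UNIV)"
    using charts[OF x] by blast
  define U where "U = h ` (I \<times> UNIV)"
  obtain g where h: "continuous_map (top_of_set (I \<times> UNIV)) S h"
    and g: "continuous_map (subtopology S U) (top_of_set I) (fst \<circ> g)" "\<And>s t. s \<in> I \<Longrightarrow> g (h (s, t)) = (s, t)"
    using chart_inverse[OF c] unfolding U_def by metis
  have "continuous_map (prod_topology (subtopology S U) euclideanreal) (prod_topology (top_of_set I) euclidean)
     (\<lambda>(y, t). ((fst \<circ> g) y, \<epsilon> * t))"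
    using g(1) by (subst continuous_map_prod_top) (auto intro!: continuous_intros)
  then have "continuous_map (prod_topology (subtopology S U) euclideanreal) S (h \<circ> (\<lambda>(y, t). ((fst \<circ> g) y, \<epsilon> * t)))"
    using h unfolding prod_top_of_set_euclidean by (rule continuous_map_compose)
  then have "continuous_map (prod_topology (subtopology S U) euclideanreal) S (\<lambda>(x, t). slide x t)"
    by (rule continuous_map_eq) (auto simp: U_def g(2) slide_chart[OF c \<epsilon>])
  moreover have "openin (prod_topology S euclideanreal) (U \<times> UNIV)" "q \<in> U \<times> UNIV"
    using chart_openin[OF c] xh q by (auto simp: U_def openin_prod_Times_iff)
  ultimately show "\<exists>U. openin (prod_topology S euclideanreal) U \<and> q \<in> U \<and>
      continuous_map (subtopology (prod_topology S euclideanreal) U) S (\<lambda>(x, t). slide x t)"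
    by (intro exI[of _ "U \<times> UNIV"]) (simp add: subtopology_Times)
qed

lemma continuous_map_height: "continuous_map S euclideanreal (\<lambda>x. \<Phi> x \<bullet> v)"
proof (rule continuous_map_local)
  fix x assume x: "x \<in> topspace S"
  obtain I h \<epsilon> p where \<epsilon>: "\<epsilon> = 1 \<or> \<epsilon> = -1" and c: "ruled_chart S \<Phi> L I h (\<lambda>_. \<epsilon> *\<^sub>R v) p"
    and xh: "x \<in> h ` (I \<times> UNIV)"
    using charts[OF x] by blast
  obtain g where g: "continuous_map (subtopology S (h ` (I \<times> UNIV))) euclideanreal (snd \<circ> g)" "\<And>s t. s \<in> I \<Longrightarrow> g (h (s, t)) = (s, t)"
    using chart_inverse[OF c] by metis
  have "continuous_map (subtopology S (h ` (I \<times> UNIV))) euclideanreal (\<lambda>y. \<epsilon> * (snd \<circ> g) y)"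
    using g(1) by (intro continuous_map_real_mult) (auto simp: o_def)
  then have "continuous_map (subtopology S (h ` (I \<times> UNIV))) euclideanreal (\<lambda>x. \<Phi> x \<bullet> v)"
    by (rule continuous_map_eq) (auto simp: g(2) chart_height[OF c \<epsilon>])
  then show "\<exists>U. openin S U \<and> x \<in> U \<and> continuous_map (subtopology S U) euclideanreal (\<lambda>x. \<Phi> x \<bullet> v)"
    using chart_openin[OF c] xh by blast
qed

lemma topspace_transversal: "x \<in> topspace transversal \<longleftrightarrow> x \<in> topspace S \<and> \<Phi> x \<bullet> v = 0"
  by (auto simp: transversal_def)

lemma continuous_map_slide_const: "continuous_map S transversal (\<lambda>x. slide x 0)"
proof -
  have "continuous_map S (prod_topology S euclideanreal) (\<lambda>x. (x, 0))"
    by (simp add: continuous_map_pairwise o_def)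
  from continuous_map_compose[OF this continuous_map_slide]
  have "continuous_map S S (\<lambda>x. slide x 0)" by (simp add: o_def)
  then show ?thesis
    unfolding transversal_def continuous_map_in_subtopology by (auto simp: height_slide)
qed

text \<open>The inverse sends a point to the foot of its leaf on the cross-section together with its
  height.\<close>

lemma homeomorphic_map_slide: "homeomorphic_map (prod_topology transversal euclideanreal) S (\<lambda>(x, t). slide x t)"
proof -
  have "homeomorphic_maps (prod_topology transversal euclideanreal) S (\<lambda>(x, t). slide x t) (\<lambda>y. (slide y 0, \<Phi> y \<bullet> v))"
    unfolding homeomorphic_maps_def
  proof (intro conjI)
    show "continuous_map (prod_topology transversal euclideanreal) S (\<lambda>(x, t). slide x t)"
      unfolding transversal_def prod_topology_subtopology
      by (rule continuous_map_from_subtopology[OF continuous_map_slide])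
    show "continuous_map S (prod_topology transversal euclideanreal) (\<lambda>y. (slide y 0, \<Phi> y \<bullet> v))"
      using continuous_map_slide_const continuous_map_height by (simp add: continuous_map_pairwise o_def)
    show "\<forall>x\<in>topspace (prod_topology transversal euclideanreal).
        (slide ((\<lambda>(x, t). slide x t) x) 0, \<Phi> ((\<lambda>(x, t). slide x t) x) \<bullet> v) = x"
      using slide_height by (auto simp: topspace_transversal slide_slide height_slide) metis
    show "\<forall>y\<in>topspace S. (\<lambda>(x, t). slide x t) (slide y 0, \<Phi> y \<bullet> v) = y"
      by (auto simp: slide_slide slide_height)
  qed
  then show ?thesis unfolding homeomorphic_map_maps by blast
qed

lemma \<Phi>_slide_transversal: "x \<in> topspace transversal \<Longrightarrow> \<Phi> (slide x t) = t *\<^sub>R v + \<Phi> x"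
  by (simp add: topspace_transversal \<Phi>_slide)

text \<open>The cross-section is the continuous image of the connected \<open>S\<close> under
  sliding to height 0.\<close>

lemma connected_space_transversal: "connected_space transversal"
proof -
  have "connectedin transversal ((\<lambda>x. slide x 0) ` topspace S)"
    using surface by (intro connectedin_continuous_map_image[OF continuous_map_slide_const])
      (simp add: immersed_surface_def connectedin_topspace)
  moreover have "(\<lambda>x. slide x 0) ` topspace S = topspace transversal"
    using slide_height slide_in height_slide by (force simp: topspace_transversal image_iff)
  ultimately show ?thesis by (simp add: connectedin_topspace)
qed

text \<open>Along a ruling the height \<epsilon> t vanishes only at t = 0, so the cross-section
  meets the chart exactly in the line t = 0, and every property is the restriction of that of the
  chart.\<close>

lemma transversal_local_parametrization:
  assumes c: "ruled_chart S \<Phi> L I h (\<lambda>_. \<epsilon> *\<^sub>R v) p" and \<epsilon>: "\<epsilon> = 1 \<or> \<epsilon> = -1"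
  shows "local_parametrization transversal \<Phi> I (\<lambda>s. h (s, 0))"
  unfolding local_parametrization_def
proof (intro conjI)
  have "local_parametrization S \<Phi> (I \<times> (UNIV :: real set)) h" using c by (simp add: ruled_chart_def)
  then have opn: "openin S (h ` (I \<times> UNIV))" and emb: "embedding_map (top_of_set (I \<times> UNIV)) S h"
    and imm: "smooth_immersion_on (I \<times> UNIV) (\<Phi> \<circ> h)" by (auto simp: local_parametrization_def)
  have height: "\<Phi> (h (s, t)) \<bullet> v = 0 \<longleftrightarrow> t = 0" if "s \<in> I" for s t
    using \<epsilon> by (auto simp: chart_height[OF c \<epsilon> that])
  have "(\<lambda>s. h (s, 0)) ` I = h ` (I \<times> UNIV) \<inter> {x. \<Phi> x \<bullet> v = 0}"
    using height by auto
  then show "openin transversal ((\<lambda>s. h (s, 0)) ` I)"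
    unfolding transversal_def openin_subtopology using opn by blast
  have "embedding_map (top_of_set I) (prod_topology (top_of_set I) euclidean) (\<lambda>s. (s, 0::real))"
    unfolding embedding_map_graph by simp
  then have "embedding_map (top_of_set I) S (h \<circ> (\<lambda>s. (s, 0)))"
    using emb unfolding prod_top_of_set_euclidean by (rule embedding_map_compose)
  then show "embedding_map (top_of_set I) transversal (\<lambda>s. h (s, 0))"
    unfolding transversal_def embedding_map_in_subtopology using height by (auto simp: o_def)
  have "open I" using imm by (auto simp: smooth_immersion_on_def intro: open_fst_Times_UNIV)
  then have "smooth_immersion_on I (\<lambda>s. (\<Phi> \<circ> h) ((s, 0) + 0))"
    by (intro smooth_immersion_on_compose_affine[OF imm])
      (auto simp: bounded_linear_Pair bounded_linear_ident bounded_linear_zero inj_def zero_prod_def)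
  then show "smooth_immersion_on I (\<Phi> \<circ> (\<lambda>s. h (s, 0)))"
    by (simp add: o_def)
qed

lemma immersed_curve_transversal: "immersed_curve transversal \<Phi>"
  unfolding immersed_curve_def
proof (intro conjI ballI)
  show "Hausdorff_space transversal" "second_countable transversal"
    using surface unfolding transversal_def immersed_surface_def
    by (auto intro: Hausdorff_space_subtopology second_countable_subtopology)
  show "connected_space transversal" by (rule connected_space_transversal)
  fix x assume "x \<in> topspace transversal"
  then have x: "x \<in> topspace S" "\<Phi> x \<bullet> v = 0" by (simp_all add: topspace_transversal)
  obtain I h \<epsilon> p s r where c: "\<epsilon> = 1 \<or> \<epsilon> = -1" "ruled_chart S \<Phi> L I h (\<lambda>_. \<epsilon> *\<^sub>R v) p" and s: "s \<in> I" "x = h (s, r)"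
    by (rule chart_point[OF x(1)])
  have "r = 0" using chart_height[OF c(2,1) s(1), of r] x(2) s(2) c(1) by auto
  then have "x \<in> (\<lambda>s. h (s, 0)) ` I" using s by blast
  with transversal_local_parametrization[OF c(2,1)]
  show "\<exists>D h. local_parametrization transversal \<Phi> (D :: real set) h \<and> x \<in> h ` D"
    by (intro exI conjI)
qed

lemma cylinder_over_transversal: "cylinder_over v transversal \<Phi> S \<Phi>"
  unfolding cylinder_over_def
proof (intro conjI ballI exI[of _ "\<lambda>(x, t). slide x t"] allI)
  show "norm v = 1" "immersed_curve transversal \<Phi>"
    "homeomorphic_map (prod_topology transversal euclideanreal) S (\<lambda>(x, t). slide x t)"
    by (fact unit immersed_curve_transversal homeomorphic_map_slide)+
  fix x t assume x: "x \<in> topspace transversal"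
  then show "\<Phi> x \<bullet> v = 0" by (simp add: topspace_transversal)
  from x show "\<Phi> ((\<lambda>(x, t). slide x t) (x, t)) = \<Phi> x + t *\<^sub>R v"
    by (simp add: \<Phi>_slide_transversal)
qed

text \<open>\<open>self_similar_curve\<close> quantifies over all parametrizations of the curve, so
  an arbitrary one has to be thickened to a chart of \<open>S\<close>. The thickening is
  \<open>h\<close> times the identity followed by the sliding homeomorphism, and in space it is a
  cylinder.\<close>

lemma local_parametrization_slide:
  fixes D :: "real set"
  assumes "local_parametrization transversal \<Phi> D h"
  shows "local_parametrization S \<Phi> (D \<times> (UNIV :: real set)) (\<lambda>(s, t). slide (h s) t)"
  unfolding local_parametrization_def
proof (intro conjI)
  have opn: "openin transversal (h ` D)" and emb: "embedding_map (top_of_set D) transversal h"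
    and imm: "smooth_immersion_on D (\<Phi> \<circ> h)" using assms by (auto simp: local_parametrization_def)
  have "openin (prod_topology transversal euclideanreal) (h ` D \<times> UNIV)"
    using opn by (simp add: openin_prod_Times_iff)
  then have "openin S ((\<lambda>(x, t). slide x t) ` (h ` D \<times> UNIV))"
    using homeomorphic_imp_open_map[OF homeomorphic_map_slide] by (simp add: open_map_def)
  moreover have "(\<lambda>(x, t). slide x t) ` (h ` D \<times> UNIV) = (\<lambda>(s, t). slide (h s) t) ` (D \<times> UNIV)"
    by force
  ultimately show "openin S ((\<lambda>(s, t). slide (h s) t) ` (D \<times> UNIV))" by simp
  have "embedding_map (prod_topology (top_of_set D) euclidean) (prod_topology transversal euclideanreal) (\<lambda>(s, t::real). (h s, t))"
    using embedding_map_prod_UNIV[OF emb, of euclideanreal] by simp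
  moreover have "embedding_map (prod_topology transversal euclideanreal) S (\<lambda>(x, t). slide x t)"
    using homeomorphic_map_slide surjective_embedding_map by blast
  ultimately have "embedding_map (prod_topology (top_of_set D) euclidean) S ((\<lambda>(x, t). slide x t) \<circ> (\<lambda>(s, t::real). (h s, t)))"
    by (rule embedding_map_compose)
  then show "embedding_map (top_of_set (D \<times> UNIV)) S (\<lambda>(s, t). slide (h s) t)"
    by (simp add: o_def case_prod_unfold prod_top_of_set_euclidean)
  have h: "h s \<in> topspace transversal" if "s \<in> D" for s using openin_subset[OF opn] that by blast
  have "smooth_immersion_on (D \<times> (UNIV :: real set)) (\<lambda>(s, t). t *\<^sub>R v + (\<Phi> \<circ> h) s)"
    using h unit by (intro smooth_immersion_on_cylinder[OF imm]) (auto simp: topspace_transversal)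
  then show "smooth_immersion_on (D \<times> (UNIV :: real set)) (\<Phi> \<circ> (\<lambda>(s, t). slide (h s) t))"
    by (rule smooth_immersion_on_cong) (auto simp: \<Phi>_slide_transversal h)
qed

lemma self_similar_curve_transversal:
  assumes "self_similar_surface lam S \<Phi>"
  shows "self_similar_curve (2 * lam) transversal \<Phi>"
  unfolding self_similar_curve_def
proof (intro conjI allI impI ballI)
  show "immersed_curve transversal \<Phi>" by (rule immersed_curve_transversal)
  fix D :: "real set" and h s assume h: "local_parametrization transversal \<Phi> D h" and s: "s \<in> D"
  let ?H = "\<lambda>(s, t). slide (h s) t"
  have "h x \<in> topspace transversal" if "x \<in> D" for x
    using h openin_subset that unfolding local_parametrization_def by blast
  note hs = this
  show "curvature_vector (\<Phi> \<circ> h) s + (2 * lam) *\<^sub>R normal_position (\<Phi> \<circ> h) s = 0"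
  proof (rule self_similar_cylinder_generator[OF _ _ unit _ _ s])
    show "smooth_immersion_on D (\<Phi> \<circ> h)" using h by (simp add: local_parametrization_def)
    show "(\<Phi> \<circ> h) x \<bullet> v = 0" if "x \<in> D" for x using hs[OF that] by (simp add: topspace_transversal)
    show "(\<Phi> \<circ> ?H) (x, t) = t *\<^sub>R v + (\<Phi> \<circ> h) x" if "x \<in> D" for x t
      using hs[OF that] by (simp add: \<Phi>_slide_transversal)
    show "mean_curvature (\<Phi> \<circ> ?H) (s, 0) N + lam * ((\<Phi> \<circ> ?H) (s, 0) \<bullet> N) = 0"
      if "unit_normal_at (\<Phi> \<circ> ?H) (s, 0) N" for N
      using assms local_parametrization_slide[OF h] that s unfolding self_similar_surface_def by force
  qed
qed

end

theorem theorem2: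
  fixes S :: "'a topology" and \<Phi> :: "'a \<Rightarrow> real^3" and lam :: real
  assumes "lam \<noteq> 0"
    and "self_similar_surface lam S \<Phi>"
    and "ruled_surface S \<Phi>"
  shows "\<exists>v (C :: 'a topology) c \<mu>.
           \<mu> \<noteq> 0 \<and> self_similar_curve \<mu> C c \<and> cylinder_over v C c S \<Phi>"
proof -
  obtain L where surface: "immersed_surface S \<Phi>" and L: "partition_on (topspace S) L"
    and charts: "\<And>x. x \<in> topspace S \<Longrightarrow> \<exists>I h \<gamma> p. ruled_chart S \<Phi> L I h \<gamma> p \<and> x \<in> h ` (I \<times> UNIV)"
    using assms(3) unfolding ruled_surface_def ruled_chart_def by metis
  have "\<exists>v. parallel_ruling S \<Phi> L v"
  proof (cases "topspace S = {}")
    case True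
    have "parallel_ruling S \<Phi> L (axis 1 1)"
      using surface L True by unfold_locales (simp_all add: norm_axis_1)
    then show ?thesis by blast
  next
    case False
    obtain v where v: "norm v = 1"
      "\<And>x. x \<in> topspace S \<Longrightarrow> \<exists>I h \<epsilon> p. (\<epsilon> = 1 \<or> \<epsilon> = -1) \<and>
         ruled_chart S \<Phi> L I h (\<lambda>_. \<epsilon> *\<^sub>R v) p \<and> x \<in> h ` (I \<times> UNIV)"
      by (rule self_similar_ruled_surface_common_direction[OF assms(1,2) L charts False], assumption, rule that)
    have "parallel_ruling S \<Phi> L v"
      by (rule parallel_ruling.intro[OF surface L v])
    then show ?thesis by blast
  qed
  then obtain v where "parallel_ruling S \<Phi> L v" by blast
  then interpret parallel_ruling S \<Phi> L v .
  have "2 * lam \<noteq> 0" using assms(1) by simp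
  then show ?thesis
    using self_similar_curve_transversal[OF assms(2)] cylinder_over_transversal by blast
qed

end
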